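(* Let $G$ be a $2$-connected outerplanar graph, embedded in the plane with all vertices on the boundary of the infinite face, such that every finite face of $G$ is odd and $|F(G)|\ge 3$. Then $c_e(G)>0$ and $$\frac{|F(G)|-1}{2c_e(G)}+1\ \le\ \frac{c_o(G)}{c_e(G)}\ \le\ \frac{|F(G)|-2}{c_e(G)}+1 .$$ In particular, $1\le c_o(G)/c_e(G)\le 2$.
   Context: All graphs are finite, simple and undirected. $F(G)$ is the set of faces of the embedded graph $G$, including the unique infinite face. A finite face is odd (resp. even) if the length of its boundary walk is odd (resp. even). $c_o(G)$ (resp. $c_e(G)$) denotes the number of distinct cycles of odd (resp. even) length in $G$ (two subgraphs are distinct if their vertex sets or edge sets differ). *)

theory Defs
  imports "HOL-Analysis.Analysis"
begin

text \<open>A graph is given by its vertex set \<open>V\<close> and its set \<open>E\<close> of edges,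
  an edge being the two-element set of its ends.\<close>

definition simple_graph :: "'a set \<Rightarrow> 'a set set \<Rightarrow> bool" where
  "simple_graph V E \<longleftrightarrow> finite V \<and> (\<forall>e\<in>E. e \<subseteq> V \<and> card e = 2)"

definition walk_between :: "'a set \<Rightarrow> 'a set set \<Rightarrow> 'a \<Rightarrow> 'a list \<Rightarrow> 'a \<Rightarrow> bool" where
  "walk_between V E u p v \<longleftrightarrow>
     p \<noteq> [] \<and> hd p = u \<and> last p = v \<and> set p \<subseteq> V \<and> successively (\<lambda>x y. {x, y} \<in> E) p"

definition connected_graph :: "'a set \<Rightarrow> 'a set set \<Rightarrow> bool" where
  "connected_graph V E \<longleftrightarrow> V \<noteq> {} \<and> (\<forall>u\<in>V. \<forall>v\<in>V. \<exists>p. walk_between V E u p v)"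

definition k_connected :: "nat \<Rightarrow> 'a set \<Rightarrow> 'a set set \<Rightarrow> bool" where
  "k_connected k V E \<longleftrightarrow>
     card V > k \<and>
     (\<forall>X\<subseteq>V. card X < k \<longrightarrow> connected_graph (V - X) {e \<in> E. e \<inter> X = {}})"

text \<open>A closed walk \<open>x\<^sub>0, x\<^sub>1, \<dots>, x\<^sub>n = x\<^sub>0\<close> is represented by the list
  \<open>[x\<^sub>0, \<dots>, x\<^bsub>n-1\<^esub>]\<close>, without repeating the start vertex; the length of the
  walk is thus the length of the list.\<close>

definition closed_walk_edges :: "'a list \<Rightarrow> 'a set list" where
  "closed_walk_edges p = map (\<lambda>i. {p ! i, p ! (Suc i mod length p)}) [0..<length p]"

definition closed_walk :: "'a set \<Rightarrow> 'a set set \<Rightarrow> 'a list \<Rightarrow> bool" where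
  "closed_walk V E p \<longleftrightarrow> p \<noteq> [] \<and> set p \<subseteq> V \<and> set (closed_walk_edges p) \<subseteq> E"

text \<open>Cycles are counted as subgraphs, i.e. as pairs of a vertex set and an edge set,
  so that neither the starting point nor the orientation matters.\<close>

definition cycles :: "'a set \<Rightarrow> 'a set set \<Rightarrow> ('a set \<times> 'a set set) set" where
  "cycles V E =
     {(set p, set (closed_walk_edges p)) |p. closed_walk V E p \<and> distinct p \<and> length p \<ge> 3}"

definition c_odd :: "'a set \<Rightarrow> 'a set set \<Rightarrow> nat" where
  "c_odd V E = card {(W, C) \<in> cycles V E. odd (card C)}"

definition c_even :: "'a set \<Rightarrow> 'a set set \<Rightarrow> nat" where
  "c_even V E = card {(W, C) \<in> cycles V E. even (card C)}"

text \<open>An embedding in the plane places a vertex \<open>v\<close> at the point \<open>pos v\<close> and draws an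
  edge \<open>e\<close> along the Jordan arc \<open>crv e\<close>; the direction in which the arc runs is
  irrelevant.\<close>

definition plane_embedding ::
    "'a set \<Rightarrow> 'a set set \<Rightarrow> ('a \<Rightarrow> complex) \<Rightarrow> ('a set \<Rightarrow> real \<Rightarrow> complex) \<Rightarrow> bool" where
  "plane_embedding V E pos crv \<longleftrightarrow>
     inj_on pos V \<and>
     (\<forall>e\<in>E. arc (crv e) \<and> {pathstart (crv e), pathfinish (crv e)} = pos ` e \<and>
             path_image (crv e) \<inter> pos ` V = pos ` e) \<and>
     (\<forall>e\<in>E. \<forall>e'\<in>E. e \<noteq> e' \<longrightarrow>
             path_image (crv e) \<inter> path_image (crv e') = pos ` (e \<inter> e'))"

definition drawing ::
    "'a set \<Rightarrow> 'a set set \<Rightarrow> ('a \<Rightarrow> complex) \<Rightarrow> ('a set \<Rightarrow> real \<Rightarrow> complex) \<Rightarrow> complex set" where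
  "drawing V E pos crv = pos ` V \<union> (\<Union>e\<in>E. path_image (crv e))"

definition faces ::
    "'a set \<Rightarrow> 'a set set \<Rightarrow> ('a \<Rightarrow> complex) \<Rightarrow> ('a set \<Rightarrow> real \<Rightarrow> complex) \<Rightarrow> complex set set" where
  "faces V E pos crv = components (- drawing V E pos crv)"

text \<open>The infinite face is the unbounded one.\<close>

definition all_vertices_on_infinite_face ::
    "'a set \<Rightarrow> 'a set set \<Rightarrow> ('a \<Rightarrow> complex) \<Rightarrow> ('a set \<Rightarrow> real \<Rightarrow> complex) \<Rightarrow> bool" where
  "all_vertices_on_infinite_face V E pos crv \<longleftrightarrow>
     (\<exists>f\<in>faces V E pos crv. \<not> bounded f \<and> pos ` V \<subseteq> frontier f)"

text \<open>The number of sides of an edge \<open>e\<close> that lie in the face \<open>f\<close>: an edge on the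
  boundary of \<open>f\<close> and of no other face (a bridge) has both its sides in \<open>f\<close>.\<close>

definition sides_in_face ::
    "'a set \<Rightarrow> 'a set set \<Rightarrow> ('a \<Rightarrow> complex) \<Rightarrow> ('a set \<Rightarrow> real \<Rightarrow> complex) \<Rightarrow>
     complex set \<Rightarrow> 'a set \<Rightarrow> nat" where
  "sides_in_face V E pos crv f e =
     (if \<not> path_image (crv e) \<subseteq> frontier f then 0
      else if \<exists>f'\<in>faces V E pos crv. f' \<noteq> f \<and> path_image (crv e) \<subseteq> frontier f' then 1
      else 2)"

text \<open>A boundary walk of \<open>f\<close> runs around the frontier of \<open>f\<close>, traversing an edge once for
  each of its sides in \<open>f\<close>. All boundary walks of \<open>f\<close> hence have the same length; if the graph is
  2-connected they are the traversals of the cycle bounding \<open>f\<close>.\<close>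

definition boundary_walk ::
    "'a set \<Rightarrow> 'a set set \<Rightarrow> ('a \<Rightarrow> complex) \<Rightarrow> ('a set \<Rightarrow> real \<Rightarrow> complex) \<Rightarrow>
     complex set \<Rightarrow> 'a list \<Rightarrow> bool" where
  "boundary_walk V E pos crv f p \<longleftrightarrow>
     closed_walk V E p \<and>
     frontier f = (\<Union>e\<in>set (closed_walk_edges p). path_image (crv e)) \<and>
     (\<forall>e\<in>E. count_list (closed_walk_edges p) e = sides_in_face V E pos crv f e)"

definition odd_face ::
    "'a set \<Rightarrow> 'a set set \<Rightarrow> ('a \<Rightarrow> complex) \<Rightarrow> ('a set \<Rightarrow> real \<Rightarrow> complex) \<Rightarrow>
     complex set \<Rightarrow> bool" where
  "odd_face V E pos crv f \<longleftrightarrow> (\<exists>p. boundary_walk V E pos crv f p \<and> odd (length p))"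

end

theory Submission
  imports Defs
begin

text \<open>A closed curve of the drawing contains no vertex, since all vertices lie on the
  unbounded face. With the theta curve lemma this makes a longest cycle Hamiltonian and all
  other edges non-crossing chords inside it, each of which splits a face in two. Hence the
  finite faces correspond to the \<open>n\<close> edges of positions \<open>i < j\<close> with \<open>j \<noteq> i + 1\<close> along the
  Hamiltonian cycle \<open>0, \<dots>, m - 1\<close>, and the cycles of \<open>G\<close> to the increasing paths from \<open>i\<close> to \<open>j\<close>
  that are closed up by such an edge.

  Let \<open>c\<close> be the largest neighbour of \<open>a\<close> below \<open>b\<close>. As no edge jumps over \<open>c\<close>, every increasing path
  from \<open>a\<close> to \<open>b\<close> except the edge \<open>{a, b}\<close> passes through \<open>c\<close>. So the numbers of paths of either
  parity satisfy a product recursion, and as all finite faces are odd, induction shows that the path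
  along the chordless polygon has the majority parity with an excess of 0 or 1. The excess over all
  edges adds up to \<open>c\<^sub>o - c\<^sub>e\<close>; it is the independence number of the dual tree, which
  lies between \<open>n / 2\<close> and \<open>n - 1\<close>.\<close>

section \<open>Edges of walks and closed walks\<close>

text \<open>Write \<open>d\<close> for the difference between majority and minority paths across an
  interval. Differences multiply under concatenation, and closing an interval with a long edge turns
  \<open>d\<close> into \<open>1 - d\<close>: the face below the edge is odd, so the edge and the
  chordless path beneath it have opposite parities. Hence \<open>d\<close> stays in
  \<open>{0, 1}\<close>, and the polygons spanning a long edge have excess 1 exactly if no other
  long edge of the face below it has excess 1. This is the greedy independent set of the dual tree
  rooted at the face below the edge of positions \<open>0\<close> and \<open>m - 1\<close>: a face
  is taken if none of its children is. Every face not taken has a taken child, which is the origin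
  of the factor 1/2 in the lower bound. In a tree with at least two nodes not every face is taken,
  which is the origin of the 2 subtracted in the upper bound. The bound 2 for the ratio also needs
  \<open>n - 1\<close> even cycles; for this the minority paths must be counted themselves, not only
  their difference to the majority.\<close>

fun path_edges :: "'a list \<Rightarrow> 'a set list" where
  "path_edges (x # y # r) = {x, y} # path_edges (y # r)"
| "path_edges _ = []"

lemma path_edges_append: "path_edges (xs @ x # ys) = path_edges (xs @ [x]) @ path_edges (x # ys)"
  by (induction xs rule: path_edges.induct) auto

lemma path_edges_conv_map:
  "path_edges p = map (\<lambda>i. {p ! i, p ! Suc i}) [0..<length p - 1]"
proof (induction p rule: path_edges.induct)
  case (1 x y r)
  then show ?case
    by (simp add: upt_conv_Cons map_Suc_upt[symmetric] del: upt_Suc)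
qed auto

text \<open>Trades indices modulo the length for an open path that returns to its start, so that
  splitting lemmas for lists apply to closed walks.\<close>

lemma closed_walk_edges_conv:
  assumes "p \<noteq> []"
  shows "closed_walk_edges p = path_edges (p @ [hd p])"
proof -
  have "{p ! i, p ! (Suc i mod length p)} = {(p @ [hd p]) ! i, (p @ [hd p]) ! Suc i}"
    if "i < length p" for i
    using assms that by (cases "Suc i = length p") (auto simp: nth_append hd_conv_nth)
  then show ?thesis by (simp add: path_edges_conv_map closed_walk_edges_def)
qed

lemma length_closed_walk_edges [simp]: "length (closed_walk_edges p) = length p"
  by (simp add: closed_walk_edges_def)

lemma successively_edges_iff: "successively (\<lambda>x y. {x, y} \<in> E) p \<longleftrightarrow> set (path_edges p) \<subseteq> E"
  by (induction p rule: path_edges.induct) auto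

lemma path_edges_rev: "set (path_edges (rev p)) = set (path_edges p)"
proof (induction p rule: path_edges.induct)
  case (1 x y r)
  have "path_edges (rev (x # y # r)) = path_edges (rev r @ [y]) @ path_edges [y, x]"
    using path_edges_append[of "rev r" y "[x]"] by simp
  then show ?case using 1 by (auto simp: insert_commute)
qed auto

lemma path_edges_subset: "e \<in> set (path_edges p) \<Longrightarrow> e \<subseteq> set p"
  by (induction p rule: path_edges.induct) auto

lemma Union_path_edges: "length p \<ge> 2 \<Longrightarrow> \<Union> (set (path_edges p)) = set p"
proof (induction p rule: path_edges.induct)
  case (1 x y r)
  then show ?case by (cases r) auto
qed auto

lemma closed_walk_edges_subset: "e \<in> set (closed_walk_edges p) \<Longrightarrow> e \<subseteq> set p"
  unfolding closed_walk_edges_def set_map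
proof (elim imageE)
  fix i assume "e = {p ! i, p ! (Suc i mod length p)}" "i \<in> set [0..<length p]"
  then show "e \<subseteq> set p" by (auto intro!: nth_mem mod_less_divisor)
qed

lemma Union_closed_walk_edges: "\<Union> (set (closed_walk_edges p)) = set p"
proof (cases p)
  case (Cons x xs)
  then show ?thesis
    using Union_path_edges[of "p @ [x]"] by (auto simp: closed_walk_edges_conv)
qed (simp add: closed_walk_edges_def)

lemma set_closed_walk_edges_split:
  "set (closed_walk_edges (x # xs @ y # ys)) =
    set (path_edges (x # xs @ [y])) \<union> set (path_edges (y # ys @ [x]))"
  using path_edges_append[of "x # xs" y "ys @ [x]"] by (simp add: closed_walk_edges_conv)

lemma set_closed_walk_edges_rotate:
  "set (closed_walk_edges (xs @ ys)) = set (closed_walk_edges (ys @ xs))"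
proof (cases xs; cases ys)
  fix x xs' y ys' assume "xs = x # xs'" "ys = y # ys'"
  then show ?thesis
    using set_closed_walk_edges_split[of x xs' y ys'] set_closed_walk_edges_split[of y ys' x xs']
    by auto
qed auto

text \<open>Only the first edge of a path without repetition contains its first vertex, so
  \<open>{x, y}\<close> must be that edge.\<close>

lemma edge_between_ends:
  assumes "distinct (x # xs @ [y])" "{x, y} \<in> set (path_edges (x # xs @ [y]))"
  shows "xs = []"
proof (cases xs)
  case (Cons z zs)
  have "{x, y} \<notin> set (path_edges (z # zs @ [y]))"
    using assms(1) Cons path_edges_subset[of "{x, y}" "z # zs @ [y]"] by auto
  then show ?thesis using assms Cons by (auto simp: doubleton_eq_iff)
qed simp

lemma distinct_path_edges: "distinct p \<Longrightarrow> distinct (path_edges p)"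
  by (induction p rule: path_edges.induct) (auto dest: path_edges_subset)

text \<open>Only the closing edge could repeat an earlier one, and it would then join the ends of a
  simple path. Length 2 is excluded since such a walk runs through its edge twice.\<close>

lemma distinct_closed_walk_edges:
  assumes "distinct p" "length p \<ge> 3"
  shows "distinct (closed_walk_edges p)"
proof -
  obtain x xs where p: "p = x # xs" using assms by (cases p) auto
  obtain ys y where xs: "xs = ys @ [y]" using assms p by (cases xs rule: rev_cases) auto
  have "closed_walk_edges p = path_edges (x # ys @ [y]) @ [{y, x}]"
    using path_edges_append[of "x # ys" y "[x]"] by (simp add: p xs closed_walk_edges_conv)
  moreover have "{y, x} \<notin> set (path_edges (x # ys @ [y]))"
    using edge_between_ends[of x ys y] assms p xs by (auto simp: insert_commute)
  ultimately show ?thesis using distinct_path_edges[of p] assms p xs by simp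
qed

lemma card_closed_walk_edges:
  assumes "distinct p" "length p \<ge> 3"
  shows "card (set (closed_walk_edges p)) = length p"
  using distinct_card[OF distinct_closed_walk_edges[OF assms]] by simp

text \<open>A normal form for a cycle cut at two of its vertices; chords and ears are all handled in
  this shape.\<close>

lemma obtain_rotation:
  assumes "distinct p" "x \<in> set p" "y \<in> set p" "x \<noteq> y"
  obtains xs ys where "distinct (x # xs @ y # ys)" "set (x # xs @ y # ys) = set p"
    "set (closed_walk_edges (x # xs @ y # ys)) = set (closed_walk_edges p)"
    "length (x # xs @ y # ys) = length p"
proof -
  obtain as bs where p: "p = as @ x # bs" using assms(2) split_list by metis
  have "y \<in> set (bs @ as)" using assms p by auto
  then obtain xs ys where q: "bs @ as = xs @ y # ys" using split_list by metis
  have eq: "x # xs @ y # ys = x # bs @ as" using q by simp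
  show ?thesis
    by (rule that[of xs ys]; unfold eq)
      (use assms(1) set_closed_walk_edges_rotate[of as "x # bs"] in \<open>auto simp: p\<close>)
qed

lemma obtain_edge_rotation:
  assumes "distinct p" "e \<in> set (closed_walk_edges p)" "length p \<ge> 3"
  obtains x y r where "e = {x, y}" "distinct (x # y # r)" "set (x # y # r) = set p"
    "set (closed_walk_edges (x # y # r)) = set (closed_walk_edges p)"
    "length (x # y # r) = length p"
proof -
  obtain i where i: "i < length p" "e = {p ! i, p ! (Suc i mod length p)}"
    using assms(2) by (auto simp: closed_walk_edges_def)
  define q where "q = rotate i p"
  have q_def': "q = drop i p @ take i p" using i(1) by (simp add: q_def rotate_drop_take)
  have q: "set (closed_walk_edges q) = set (closed_walk_edges p)" "distinct q" "set q = set p"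
    "length q = length p"
    using set_closed_walk_edges_rotate[of "take i p" "drop i p"] assms(1)
    by (simp_all add: q_def' flip: q_def') (simp_all add: q_def)
  have *: "q ! 0 = p ! i" "q ! 1 = p ! (Suc i mod length p)"
    using i(1) assms(3) by (auto simp: q_def' nth_append mod_Suc not_less_eq less_Suc_eq)
  obtain x y r where "q = x # y # r" using q(4) assms(3)
    by (cases q; cases "tl q") auto
  then show ?thesis using that[of x y r] q * i(2) by simp
qed

section \<open>Parity of the polygons of a noncrossing chord system\<close>

text \<open>In an interval of positions, \<open>A\<close> and \<open>B\<close> count the increasing paths between its ends whose
  length has the parity of the chordless path, resp. the other parity; \<open>Od\<close> and \<open>Ev\<close> count the
  odd and even polygons, and \<open>N\<close> the edges of nonconsecutive positions.\<close>

definition balanced :: "nat \<Rightarrow> nat \<Rightarrow> nat \<Rightarrow> nat \<Rightarrow> nat \<Rightarrow> bool" where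
  "balanced A B Od Ev N \<longleftrightarrow> 1 \<le> A \<and> (A = B \<or> A = Suc B) \<and>
     2 * Ev + N + (if A = B then 1 else 0) \<le> 2 * Od \<and>
     Od \<le> Ev + N \<and> (A = Suc B \<longrightarrow> 1 \<le> N \<longrightarrow> Od < Ev + N) \<and> N \<le> Ev + B"

text \<open>The last equation is \<open>(A1 - B1) * (A2 - B2) = X - Y\<close> with both factors in
  \<open>{0, 1}\<close>, written without subtraction on the naturals.\<close>

lemma balanced_product_aux:
  fixes A1 A2 B1 B2 :: nat
  assumes "1 \<le> A1" "1 \<le> A2" "A1 = B1 \<or> A1 = Suc B1" "A2 = B2 \<or> A2 = Suc B2"
  shows "1 \<le> A1 * A2 + B1 * B2" "B1 + B2 \<le> A1 * B2 + B1 * A2"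
    "A1 * A2 + B1 * B2 = A1 * B2 + B1 * A2 + (if A1 = B1 \<or> A2 = B2 then 0 else 1)"
proof -
  obtain a1 a2 where a: "A1 = Suc a1" "A2 = Suc a2"
    using assms by (metis Suc_le_D One_nat_def)
  show "1 \<le> A1 * A2 + B1 * B2" by (simp add: a)
  show "B1 + B2 \<le> A1 * B2 + B1 * A2" by (simp add: a)
  show "A1 * A2 + B1 * B2 = A1 * B2 + B1 * A2 + (if A1 = B1 \<or> A2 = B2 then 0 else 1)"
    using assms(3,4) by (auto simp: algebra_simps)
qed

text \<open>\<open>A = B\<close> records that some face bordering the chordless path has been taken;
  a concatenation has this property as soon as one part has it. The summand 1 in the lower bound is
  a reserve: it pays for the untaken face that a later closing edge puts above a taken one.\<close>

lemma balanced_concat: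
  assumes "balanced A1 B1 Od1 E1 N1" "balanced A2 B2 Od2 E2 N2"
  shows "balanced (A1 * A2 + B1 * B2) (A1 * B2 + B1 * A2) (Od1 + Od2) (E1 + E2) (N1 + N2)"
proof -
  define X Y where "X = A1 * A2 + B1 * B2" and "Y = A1 * B2 + B1 * A2"
  have "1 \<le> X" "B1 + B2 \<le> Y" "X = Y + (if A1 = B1 \<or> A2 = B2 then 0 else 1)"
    using balanced_product_aux[of A1 A2 B1 B2] assms unfolding balanced_def X_def Y_def by blast+
  then show ?thesis
    using assms unfolding balanced_def X_def[symmetric] Y_def[symmetric]
    by (cases "A1 = B1"; cases "A2 = B2"; auto)
qed

text \<open>The new edge closes each of the \<open>X\<close> majority paths to an odd polygon and
  each of the \<open>Y\<close> minority paths to an even one. It then becomes the chordless path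
  itself, with the parity of the former minority; this is why the counts swap to
  \<open>Suc Y\<close> and \<open>X\<close>. The reserve of \<open>balanced\<close> is spent if
  \<open>X = Y\<close> and built up if \<open>X = Suc Y\<close>.\<close>

lemma balanced_close:
  assumes "balanced A1 B1 Od1 E1 N1" "balanced A2 B2 Od2 E2 N2"
  defines "X \<equiv> A1 * A2 + B1 * B2" and "Y \<equiv> A1 * B2 + B1 * A2"
  shows "balanced (Suc Y) X (Od1 + Od2 + X) (E1 + E2 + Y) (N1 + N2 + 1)"
    "N1 + N2 \<le> E1 + E2 + Y"
    "N1 + N2 \<ge> 1 \<Longrightarrow> Od1 + Od2 + X < (E1 + E2 + Y) + (N1 + N2 + 1)"
proof -
  have *: "1 \<le> X" "B1 + B2 \<le> Y" "X = Y + (if A1 = B1 \<or> A2 = B2 then 0 else 1)"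
    using balanced_product_aux[of A1 A2 B1 B2] assms unfolding balanced_def X_def Y_def by blast+
  show "balanced (Suc Y) X (Od1 + Od2 + X) (E1 + E2 + Y) (N1 + N2 + 1)"
    using assms(1,2) * unfolding balanced_def
    by (cases "A1 = B1"; cases "A2 = B2"; auto)
  show "N1 + N2 \<le> E1 + E2 + Y"
    using assms(1,2) * unfolding balanced_def by linarith
  show "N1 + N2 \<ge> 1 \<Longrightarrow> Od1 + Od2 + X < (E1 + E2 + Y) + (N1 + N2 + 1)"
    using assms(1,2) * unfolding balanced_def
    by (cases "A1 = B1"; cases "A2 = B2"; auto)
qed

text \<open>What the induction needs of the drawing: vertices are positions along the Hamiltonian
  cycle, \<open>R\<close> is adjacency from the smaller to the larger position,
  \<open>R_nested\<close> says that chords do not cross, and \<open>odd_polygon\<close> is the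
  oddness of the faces, stated for polygons without chords.\<close>

locale nested_chords =
  fixes m :: nat and R :: "nat \<Rightarrow> nat \<Rightarrow> bool"
  assumes R_less: "R i j \<Longrightarrow> i < j"
    and R_bound: "R i j \<Longrightarrow> j < m"
    and R_Suc: "Suc i < m \<Longrightarrow> R i (Suc i)"
    and R_top: "R 0 (m - 1)"
    and m_ge_3: "3 \<le> m"
    and R_nested: "R a b \<Longrightarrow> R c d \<Longrightarrow> a < c \<Longrightarrow> c < b \<Longrightarrow> \<not> b < d"
    and odd_polygon: "length l \<ge> 3 \<Longrightarrow> successively R l \<Longrightarrow> R (hd l) (last l) \<Longrightarrow>
      (\<And>u v. u \<in> set l \<Longrightarrow> v \<in> set l \<Longrightarrow> R u v \<Longrightarrow> {u, v} \<in> set (closed_walk_edges l)) \<Longrightarrow>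
      odd (length l)"
begin

definition monotone_paths :: "nat \<Rightarrow> nat \<Rightarrow> nat list set" where
  "monotone_paths a b = {l. l \<noteq> [] \<and> hd l = a \<and> last l = b \<and> successively R l}"

definition polygons :: "nat list set" where
  "polygons = {l. length l \<ge> 3 \<and> successively R l \<and> R (hd l) (last l)}"

text \<open>The parity is that of the number of vertices, so \<open>True\<close> stands for an odd
  number of edges. For polygons the length of the list is the length of the cycle.\<close>

definition num_paths :: "bool \<Rightarrow> nat \<Rightarrow> nat \<Rightarrow> nat" where
  "num_paths k a b = card {l \<in> monotone_paths a b. even (length l) = k}"

definition num_polygons :: "bool \<Rightarrow> nat \<Rightarrow> nat \<Rightarrow> nat" where
  "num_polygons k a b = card {l \<in> polygons. a \<le> hd l \<and> last l \<le> b \<and> even (length l) = k}"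

definition long_edges :: "nat \<Rightarrow> nat \<Rightarrow> (nat \<times> nat) set" where
  "long_edges a b = {(u, v). R u v \<and> Suc u < v \<and> a \<le> u \<and> v \<le> b}"

lemma sorted_if_successively: "successively R l \<Longrightarrow> sorted_wrt (<) l"
proof -
  assume "successively R l"
  then have "successively (<) l" by (rule successively_mono) (auto dest: R_less)
  then show ?thesis by (simp add: successively_conv_sorted_wrt transp_on_less)
qed

lemma successively_hd_last:
  assumes "successively R l" "x \<in> set l"
  shows "hd l \<le> x" "x \<le> last l"
proof -
  have *: "sorted_wrt (<) l" using assms sorted_if_successively by blast
  show "hd l \<le> x" using * assms(2) by (cases l) auto
  show "x \<le> last l" using * assms(2) by (cases l rule: rev_cases) (auto simp: sorted_wrt_append)
qed

lemma successively_set_bound: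
  assumes "successively R l" "last l < m"
  shows "set l \<subseteq> {..<m}"
  using successively_hd_last[OF assms(1)] assms(2) by force

lemma finite_bounded: "finite {l. successively R l \<and> last l < m}"
proof (rule finite_subset)
  show "{l. successively R l \<and> last l < m} \<subseteq> {l. set l \<subseteq> {..<m} \<and> distinct l}"
    using successively_set_bound sorted_if_successively
    by (fastforce simp: strict_sorted_iff)
  show "finite {l. set l \<subseteq> {..<m} \<and> distinct l}"
    by (rule finite_subset_distinct) simp
qed

lemma finite_monotone_paths [simp]: "b < m \<Longrightarrow> finite (monotone_paths a b)"
  by (rule finite_subset[OF _ finite_bounded]) (auto simp: monotone_paths_def)

lemma finite_polygons [simp]: "finite polygons"
  by (rule finite_subset[OF _ finite_bounded]) (auto simp: polygons_def dest: R_bound)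

lemma finite_long_edges [simp]: "finite (long_edges a b)"
  by (rule finite_subset[of _ "{..<m} \<times> {..<m}"])
    (auto simp: long_edges_def dest: R_bound R_less)

text \<open>A discrete intermediate value argument: an increasing path that passes \<open>c\<close>
  without visiting it has an edge across \<open>c\<close>.\<close>

lemma successively_jump:
  assumes "successively R l" "l \<noteq> []" "hd l \<le> c" "c \<le> last l" "c \<notin> set l"
  shows "\<exists>xs u v ys. l = xs @ u # v # ys \<and> u < c \<and> c < v"
  using assms
proof (induction l)
  case (Cons x l)
  show ?case
  proof (cases l)
    case Nil then show ?thesis using Cons by auto
  next
    case l: (Cons y l')
    show ?thesis
    proof (cases "y < c")
      case True
      then obtain xs u v ys where "l = xs @ u # v # ys" "u < c" "c < v"
        using Cons l by (auto simp: successively_Cons)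
      then show ?thesis by (intro exI[of _ "x # xs"]) auto
    next
      case False
      then have "x < c" "c < y" using Cons.prems l by auto
      then show ?thesis using l by (intro exI[of _ "[]"]) auto
    qed
  qed
qed simp

lemma obtain_apex:
  assumes "Suc a < b" "b < m"
  obtains c where "R a c" "a < c" "c < b" "\<And>v. R a v \<Longrightarrow> v < b \<Longrightarrow> v \<le> c"
proof -
  let ?S = "{c. R a c \<and> c < b}"
  have "finite ?S" by simp
  moreover have "Suc a \<in> ?S" using R_Suc[of a] assms by simp
  ultimately have "Max ?S \<in> ?S" "\<And>v. v \<in> ?S \<Longrightarrow> v \<le> Max ?S"
    using Max_in[of ?S] Max_ge[of ?S] by blast+
  then show thesis using that[of "Max ?S"] R_less by blast
qed

section \<open>Splitting an interval at its apex\<close>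

context
  fixes a b c :: nat
  assumes bm: "b < m" and apex: "R a c" "c < b" "\<And>v. R a v \<Longrightarrow> v < b \<Longrightarrow> v \<le> c"
begin

lemma less_apex: "a < c" using apex(1) R_less by blast

text \<open>The edge \<open>{u, v}\<close> that jumps over \<open>c\<close> must start at
  \<open>a\<close>, as it would otherwise cross \<open>{a, c}\<close>; by maximality of
  \<open>c\<close> it then ends at \<open>b\<close>.\<close>

lemma path_avoiding_apex:
  assumes "l \<in> monotone_paths a b" "c \<notin> set l"
  shows "l = [a, b]"
proof -
  have l: "l \<noteq> []" "hd l = a" "last l = b" "successively R l"
    using assms by (auto simp: monotone_paths_def)
  obtain xs u v ys where l': "l = xs @ u # v # ys" "u < c" "c < v"
    using successively_jump[of l c] l assms(2) less_apex apex(2) by auto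
  have R: "R u v" using l(4) l'(1) by (simp add: successively_append_iff)
  have bounds: "a \<le> u" "v \<le> b" using successively_hd_last[OF l(4)] l l' by auto
  have "a = u" using R_nested[OF apex(1) R] bounds l'(2,3) by force
  then have "v = b" using apex(3)[of v] R bounds l'(3) by force
  have s: "sorted_wrt (<) l" using sorted_if_successively l by blast
  have "xs = []" using s l l'(1) \<open>a = u\<close> by (cases xs) (auto simp: sorted_wrt_append)
  moreover have "ys = []" using s l l'(1) \<open>v = b\<close>
    by (cases ys rule: rev_cases) (auto simp: sorted_wrt_append)
  ultimately show ?thesis using l' \<open>a = u\<close> \<open>v = b\<close> by simp
qed

text \<open>The two halves share the vertex \<open>c\<close>, so the length of the glued list is one
  less than the sum; this shift turns \<open>k\<close> into its negation in the first
  product.\<close>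

lemma card_paths_through_apex:
  "card {l \<in> monotone_paths a b. c \<in> set l \<and> even (length l) = k} =
    num_paths True a c * num_paths (\<not> k) c b + num_paths False a c * num_paths k c b"
proof -
  let ?P = "\<lambda>k x y. {l \<in> monotone_paths x y. even (length l) = k}"
  let ?D = "?P True a c \<times> ?P (\<not> k) c b \<union> ?P False a c \<times> ?P k c b"
  let ?f = "\<lambda>(l1, l2). l1 @ tl l2"
  have shape: "\<exists>xs ys. l1 = xs @ [c] \<and> l2 = c # ys"
    if "l1 \<in> monotone_paths a c" "l2 \<in> monotone_paths c b" for l1 l2
  proof -
    have "l1 = butlast l1 @ [c]" "l2 = c # tl l2"
      using that append_butlast_last_id[of l1] by (auto simp: monotone_paths_def)
    then show ?thesis by blast
  qed
  have "inj_on ?f (monotone_paths a c \<times> monotone_paths c b)"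
  proof (rule inj_onI, clarify)
    fix l1 l2 l1' l2'
    assume *: "l1 \<in> monotone_paths a c" "l2 \<in> monotone_paths c b"
      "l1' \<in> monotone_paths a c" "l2' \<in> monotone_paths c b" "l1 @ tl l2 = l1' @ tl l2'"
    obtain xs ys xs' ys' where **: "l1 = xs @ [c]" "l2 = c # ys" "l1' = xs' @ [c]" "l2' = c # ys'"
      using shape[OF *(1,2)] shape[OF *(3,4)] by blast
    have "distinct l1" "distinct l2"
      using * sorted_if_successively by (auto simp: monotone_paths_def strict_sorted_iff)
    then have "c \<notin> set xs" "c \<notin> set ys" using ** by auto
    then show "l1 = l1' \<and> l2 = l2'" using *(5) ** append_Cons_eq_iff[of c xs ys xs' ys'] by simp
  qed
  then have inj: "inj_on ?f ?D" by (rule inj_on_subset) auto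
  have "{l \<in> monotone_paths a b. c \<in> set l \<and> even (length l) = k} = ?f ` ?D"
  proof (intro equalityI subsetI)
    fix l assume "l \<in> {l \<in> monotone_paths a b. c \<in> set l \<and> even (length l) = k}"
    then have l: "l \<noteq> []" "hd l = a" "last l = b" "successively R l" "c \<in> set l"
      "even (length l) = k"
      by (auto simp: monotone_paths_def)
    obtain xs ys where xs: "l = xs @ c # ys" using l(5) split_list by metis
    have "(xs @ [c], c # ys) \<in> ?D"
      using l xs by (auto simp: monotone_paths_def successively_append_iff hd_append split: if_splits)
    then show "l \<in> ?f ` ?D" using xs by (intro image_eqI[of _ _ "(xs @ [c], c # ys)"]) auto
  next
    fix l assume "l \<in> ?f ` ?D"
    then obtain l1 l2 where l: "l = l1 @ tl l2" "(l1, l2) \<in> ?D" by auto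
    then have *: "l1 \<in> monotone_paths a c" "l2 \<in> monotone_paths c b" by auto
    obtain xs ys where s: "l1 = xs @ [c]" "l2 = c # ys" using shape[OF *] by auto
    have "even (length l) = k" using l s by auto
    moreover have "l \<in> monotone_paths a b"
      using * s l(1)
      by (auto simp: monotone_paths_def successively_append_iff successively_Cons hd_append split: if_splits)
    ultimately show "l \<in> {l \<in> monotone_paths a b. c \<in> set l \<and> even (length l) = k}"
      using l s by auto
  qed
  then have "card {l \<in> monotone_paths a b. c \<in> set l \<and> even (length l) = k} = card ?D"
    using card_image[OF inj] by simp
  also have "\<dots> = card (?P True a c \<times> ?P (\<not> k) c b) + card (?P False a c \<times> ?P k c b)"
    using bm apex(2) by (intro card_Un_disjoint) auto
  finally show ?thesis by (simp add: num_paths_def card_cartesian_product)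
qed

abbreviation through :: "bool \<Rightarrow> nat" where
  "through k \<equiv> num_paths True a c * num_paths (\<not> k) c b + num_paths False a c * num_paths k c b"

lemma num_paths_step: "num_paths k a b = through k + (if R a b \<and> k then 1 else 0)"
proof -
  have "{l \<in> monotone_paths a b. even (length l) = k} =
      {l \<in> monotone_paths a b. c \<in> set l \<and> even (length l) = k} \<union> (if R a b \<and> k then {[a, b]} else {})"
    (is "?L = ?M \<union> ?N")
  proof (intro equalityI subsetI)
    fix l assume l: "l \<in> ?L"
    show "l \<in> ?M \<union> ?N"
    proof (cases "c \<in> set l")
      case False
      then have "l = [a, b]" using path_avoiding_apex l by blast
      then show ?thesis using l by (auto simp: monotone_paths_def)
    qed (use l in auto)
  next
    fix l assume "l \<in> ?M \<union> ?N"
    then show "l \<in> ?L" by (auto simp: monotone_paths_def split: if_splits)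
  qed
  moreover have "c \<notin> set [a, b]" using less_apex apex(2) by auto
  ultimately have "num_paths k a b = card {l \<in> monotone_paths a b. c \<in> set l \<and> even (length l) = k}
      + card (if R a b \<and> k then {[a, b]} else {})"
    unfolding num_paths_def[of k a b] using bm by (simp add: card_Un_disjoint)
  then show ?thesis by (simp add: card_paths_through_apex)
qed

text \<open>An edge from \<open>a\<close> beyond \<open>c\<close> can only be \<open>{a, b}\<close>
  by maximality of \<open>c\<close>, and an edge from strictly between \<open>a\<close> and
  \<open>c\<close> to beyond \<open>c\<close> would cross \<open>{a, c}\<close>.\<close>

lemma edge_within_parts:
  assumes "R u v" "a \<le> u" "v \<le> b"
  shows "v \<le> c \<or> c \<le> u \<or> (u = a \<and> v = b)"
  using assms apex(3)[of v] R_nested[OF apex(1) assms(1)] by (cases "u = a") auto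

text \<open>A polygon is located by the edge joining its first and last vertex. This edge lies in
  one of the two parts or is \<open>{a, b}\<close>, and in the latter case the rest of the polygon
  is a path through \<open>c\<close>.\<close>

lemma num_polygons_step:
  "num_polygons k a b = num_polygons k a c + num_polygons k c b + (if R a b then through k else 0)"
proof -
  let ?Q = "\<lambda>a b. {l \<in> polygons. a \<le> hd l \<and> last l \<le> b \<and> even (length l) = k}"
  let ?T = "if R a b then {l \<in> monotone_paths a b. c \<in> set l \<and> even (length l) = k} else {}"
  have T: "?T = {l \<in> polygons. hd l = a \<and> last l = b \<and> even (length l) = k}"
  proof -
    have "(l \<in> monotone_paths a b \<and> c \<in> set l) = (l \<in> polygons \<and> hd l = a \<and> last l = b)" if "R a b" for l
    proof
      assume "l \<in> monotone_paths a b \<and> c \<in> set l"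
      then have l: "l \<noteq> []" "hd l = a" "last l = b" "successively R l" "c \<in> set l"
        by (auto simp: monotone_paths_def)
      have "distinct l" using sorted_if_successively[OF l(4)] by (simp add: strict_sorted_iff)
      have "{a, c, b} \<subseteq> set l" using l by auto
      then have "card {a, c, b} \<le> card (set l)" by (intro card_mono) auto
      then have "length l \<ge> 3" using less_apex apex(2) distinct_card[OF \<open>distinct l\<close>] by auto
      then show "l \<in> polygons \<and> hd l = a \<and> last l = b" using l that by (auto simp: polygons_def)
    next
      assume "l \<in> polygons \<and> hd l = a \<and> last l = b"
      then have "l \<in> monotone_paths a b" "length l \<ge> 3"
        unfolding polygons_def monotone_paths_def by force+
      then have "l \<in> monotone_paths a b" "l \<noteq> [a, b]" by auto
      then show "l \<in> monotone_paths a b \<and> c \<in> set l"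
        using path_avoiding_apex[of l] by blast
    qed
    then show ?thesis by (auto simp: polygons_def)
  qed
  have "?Q a b = (?Q a c \<union> ?Q c b) \<union> ?T"
  proof (intro equalityI subsetI)
    fix l assume l: "l \<in> ?Q a b"
    then have "R (hd l) (last l)" by (auto simp: polygons_def)
    then show "l \<in> (?Q a c \<union> ?Q c b) \<union> ?T"
      using edge_within_parts[of "hd l" "last l"] l by (auto simp: T simp del: if_split_asm)
  next
    fix l assume "l \<in> (?Q a c \<union> ?Q c b) \<union> ?T"
    then show "l \<in> ?Q a b" unfolding T using less_apex apex(2) by auto
  qed
  moreover have "?Q a c \<inter> ?Q c b = {}" "(?Q a c \<union> ?Q c b) \<inter> ?T = {}"
    unfolding T using less_apex apex(2) by (auto simp: polygons_def dest!: R_less)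
  moreover have "finite ?T" unfolding T by simp
  ultimately have "card (?Q a b) = card (?Q a c) + card (?Q c b) + card ?T"
    by (simp add: card_Un_disjoint)
  then show ?thesis
    using card_paths_through_apex by (simp add: num_polygons_def)
qed

lemma card_long_edges_step:
  "card (long_edges a b) =
    card (long_edges a c) + card (long_edges c b) + (if R a b then 1 else 0)"
proof -
  let ?T = "if R a b then {(a, b)} else {}"
  have "long_edges a b = (long_edges a c \<union> long_edges c b) \<union> ?T"
    using less_apex apex(2) by (auto simp: long_edges_def dest: edge_within_parts)
  moreover have "long_edges a c \<inter> long_edges c b = {}"
    "(long_edges a c \<union> long_edges c b) \<inter> ?T = {}"
    using less_apex apex(2) by (auto simp: long_edges_def)
  ultimately show ?thesis by (simp add: card_Un_disjoint)
qed

end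

definition chordless :: "nat list \<Rightarrow> bool" where
  "chordless l \<longleftrightarrow> (\<forall>u\<in>set l. \<forall>v\<in>set l. R u v \<longrightarrow> {u, v} \<in> set (path_edges l))"

lemma chordless_adjacent:
  assumes "l \<in> monotone_paths a b" "chordless l" "R a b"
  shows "l = [a, b]"
proof -
  have l: "l \<noteq> []" "hd l = a" "last l = b" "successively R l"
    using assms by (auto simp: monotone_paths_def)
  have "a \<noteq> b" using R_less[OF assms(3)] by simp
  have "{a, b} \<in> set (path_edges l)"
    using assms(2,3) l unfolding chordless_def by (metis hd_in_set last_in_set)
  moreover obtain xs where "l = a # xs @ [b]"
    using l \<open>a \<noteq> b\<close> by (metis append_butlast_last_id last_ConsL last_tl list.collapse)
  moreover have "distinct l" using sorted_if_successively[OF l(4)] by (simp add: strict_sorted_iff)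
  ultimately show ?thesis using edge_between_ends[of a xs b] by simp
qed

text \<open>The chordless path determines which parity is the majority, so the induction carries it
  along as a witness. The clauses for \<open>R a b\<close> cannot be part of
  \<open>balanced\<close>, as concatenation destroys them: two single faces side by side have two
  long edges, two odd polygons and no even one.\<close>

lemma interval_balanced:
  assumes "a < b" "b < m"
  shows "\<exists>l\<in>monotone_paths a b. chordless l \<and>
    balanced (num_paths (even (length l)) a b) (num_paths (odd (length l)) a b)
      (num_polygons False a b) (num_polygons True a b) (card (long_edges a b)) \<and>
    (R a b \<longrightarrow> card (long_edges a b) \<le> Suc (num_polygons True a b) \<and>
      (2 \<le> card (long_edges a b) \<longrightarrow>
        num_polygons False a b < num_polygons True a b + card (long_edges a b)))"
  using assms
proof (induction "b - a" arbitrary: a b rule: less_induct)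
  case less
  show ?case
  proof (cases "b = Suc a")
    case True
    have R: "R a b" using R_Suc[of a] less.prems True by simp
    have "l = [a, b]" if "l \<in> monotone_paths a b" for l
    proof -
      have l: "l \<noteq> []" "hd l = a" "last l = b" "sorted_wrt (<) l"
        using that sorted_if_successively by (auto simp: monotone_paths_def)
      obtain xs where xs: "l = a # xs @ [b]"
        using l less.prems(1) by (metis append_butlast_last_id last_ConsL last_tl list.collapse less_irrefl)
      then have "xs = []" using l(4) True by (cases xs) auto
      then show ?thesis using xs by simp
    qed
    then have paths: "monotone_paths a b = {[a, b]}" using R by (auto simp: monotone_paths_def)
    have edges: "long_edges a b = {}" using True by (auto simp: long_edges_def)
    have "num_polygons k a b = 0" for k
    proof -
      have "\<not> (a \<le> hd l \<and> last l \<le> b)" if "l \<in> polygons" for l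
      proof
        assume *: "a \<le> hd l \<and> last l \<le> b"
        have l: "length l \<ge> 3" "successively R l" using that by (auto simp: polygons_def)
        have "set l \<subseteq> {a, b}" using successively_hd_last[OF l(2)] * True by force
        then have "card (set l) \<le> card {a, b}" by (intro card_mono) auto
        moreover have "distinct l" using sorted_if_successively[OF l(2)] by (simp add: strict_sorted_iff)
        ultimately show False using l(1) distinct_card[of l] by (auto simp: True)
      qed
      then have "{l \<in> polygons. a \<le> hd l \<and> last l \<le> b \<and> even (length l) = k} = {}" by blast
      then show ?thesis by (simp add: num_polygons_def)
    qed
    moreover have "num_paths True a b = 1" "num_paths False a b = 0"
    proof -
      have "{l \<in> {[a, b]}. even (length l) = True} = {[a, b]}"
        "{l \<in> {[a, b]}. even (length l) = False} = {}" by auto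
      then show "num_paths True a b = 1" "num_paths False a b = 0"
        by (simp_all only: num_paths_def paths) simp_all
    qed
    moreover have "chordless [a, b]" using R_less by (auto simp: chordless_def)
    ultimately show ?thesis
      by (simp add: paths edges balanced_def)
  next
    case False
    then have "Suc a < b" using less.prems by simp
    then obtain c where c: "R a c" "a < c" "c < b" "\<And>v. R a v \<Longrightarrow> v < b \<Longrightarrow> v \<le> c"
      using obtain_apex less.prems(2) by metis
    have "c - a < b - a" "c < m" using c less.prems by auto
    then obtain l1 where l1: "l1 \<in> monotone_paths a c" "chordless l1"
      "balanced (num_paths (even (length l1)) a c) (num_paths (odd (length l1)) a c)
        (num_polygons False a c) (num_polygons True a c) (card (long_edges a c))"
      using less.hyps[of c a] c(2) by blast
    \<comment> \<open>On the left part the chordless path is the edge itself, which fixes the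
      majority parity there.\<close>
    have "l1 = [a, c]" using chordless_adjacent[OF l1(1,2) c(1)] .
    then have bal1: "balanced (num_paths True a c) (num_paths False a c)
        (num_polygons False a c) (num_polygons True a c) (card (long_edges a c))"
      using l1(3) by simp
    have "b - c < b - a" using c less.prems by auto
    then obtain l2 where l2: "l2 \<in> monotone_paths c b" "chordless l2" and
      bal2: "balanced (num_paths (even (length l2)) c b) (num_paths (odd (length l2)) c b)
        (num_polygons False c b) (num_polygons True c b) (card (long_edges c b))"
      using less.hyps[of b c] c(3) less.prems(2) by blast
    obtain r where r: "l2 = c # r" "r \<noteq> []" "last r = b" "successively R (c # r)"
    proof -
      have "l2 \<noteq> []" "hd l2 = c" "last l2 = b" "successively R l2"
        using l2(1) by (auto simp: monotone_paths_def)
      then show ?thesis using that[of "tl l2"] c(3) by (cases l2) (auto split: if_splits)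
    qed
    define l where "l = a # l2"
    have l: "l \<in> monotone_paths a b"
      using r c(1) by (auto simp: l_def monotone_paths_def)
    have inner: "{u, v} \<in> set (path_edges l)" if "u \<in> set l" "v \<in> set l" "R u v" "\<not> (u = a \<and> v = b)" for u v
    proof -
      have v: "v \<le> b" "a \<le> u" "v \<noteq> a"
        using successively_hd_last[of l] l that R_less[OF that(3)] by (fastforce simp: monotone_paths_def)+
      then have v2: "v \<in> set l2" using that by (auto simp: l_def)
      then have "c \<le> v" using successively_hd_last[OF r(4)] r(1) by auto
      show ?thesis
      proof (cases "u = a")
        case True
        then have "v = c" using c(4)[of v] that(3,4) v \<open>c \<le> v\<close> by fastforce
        then show ?thesis using True by (simp add: l_def r)
      next
        case False
        then have "{u, v} \<in> set (path_edges l2)"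
          using l2(2) that v2 by (auto simp: chordless_def l_def)
        then show ?thesis by (simp add: l_def r)
      qed
    qed
    define k where "k \<longleftrightarrow> even (length l2)"
    have lenl: "length l = Suc (length l2)" by (simp add: l_def)
    note paths_step = num_paths_step[OF less.prems(2) c(1,3,4)]
    note polygons_step = num_polygons_step[OF less.prems(2) c(1,3,4)]
    note edges_step = card_long_edges_step[OF less.prems(2) c(1,3,4)]
    have bal2': "balanced (num_paths k c b) (num_paths (\<not> k) c b)
        (num_polygons False c b) (num_polygons True c b) (card (long_edges c b))"
      using bal2 by (simp add: k_def)
    show ?thesis
    proof (cases "R a b")
      case False
      have "chordless l" unfolding chordless_def using inner False by blast
      moreover have "balanced (num_paths (\<not> k) a b) (num_paths k a b)
        (num_polygons False a b) (num_polygons True a b) (card (long_edges a b))"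
        using balanced_concat[OF bal1 bal2'] False
        by (simp add: paths_step polygons_step edges_step)
      ultimately show ?thesis
        using l False by (intro bexI[of _ l]) (auto simp: lenl k_def)
    next
      case True
      have "length l \<ge> 3" using r by (cases r) (auto simp: l_def)
      moreover have "{u, v} \<in> set (closed_walk_edges l)" if "u \<in> set l" "v \<in> set l" "R u v" for u v
      proof (cases "u = a \<and> v = b")
        case True
        obtain ys where "l = a # ys @ [b]"
          using r by (metis append_butlast_last_id append_Cons l_def)
        then show ?thesis
          using True set_closed_walk_edges_split[of a ys b "[]"] by (simp add: insert_commute)
      next
        case False
        obtain ys where "l = a # ys @ [b]"
          using r by (metis append_butlast_last_id append_Cons l_def)
        then show ?thesis
          using inner[OF that False] set_closed_walk_edges_split[of a ys b "[]"] by simp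
      qed
      \<comment> \<open>Here the oddness of the faces enters: the chordless path through
        \<open>c\<close>, closed by \<open>{a, b}\<close>, is a polygon without chords.\<close>
      ultimately have "odd (length l)"
        using odd_polygon[of l] l True by (auto simp: monotone_paths_def)
      then have k: "k" by (simp add: lenl k_def)
      then have bal2'': "balanced (num_paths True c b) (num_paths False c b)
        (num_polygons False c b) (num_polygons True c b) (card (long_edges c b))"
        using bal2' by simp
      note close = balanced_close[OF bal1 bal2'']
      have "balanced (num_paths True a b) (num_paths False a b)
        (num_polygons False a b) (num_polygons True a b) (card (long_edges a b))"
        using close(1) True by (simp add: paths_step polygons_step edges_step)
      moreover have "card (long_edges a b) \<le> Suc (num_polygons True a b)"
        using close(2) True by (simp add: polygons_step edges_step)
      moreover have "num_polygons False a b < num_polygons True a b + card (long_edges a b)"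
        if "2 \<le> card (long_edges a b)"
        using close(3) True that by (simp add: polygons_step edges_step)
      \<comment> \<open>With the edge present, the witness changes to the two-vertex path, whose
        parity is the one counted by \<open>Suc Y\<close> in \<open>balanced_close\<close>.\<close>
      moreover have "[a, b] \<in> monotone_paths a b" "chordless [a, b]"
        using True R_less by (auto simp: monotone_paths_def chordless_def)
      ultimately show ?thesis by (intro bexI[of _ "[a, b]"]) auto
    qed
  qed
qed

text \<open>The whole interval is closed by the edge \<open>R_top\<close>, so the clauses of
  \<open>interval_balanced\<close> for adjacent ends apply. A single face, with one odd polygon and
  no even one, shows why the strict bound asks for \<open>2 \<le> n\<close>.\<close>

theorem polygon_parity_bounds:
  defines "n \<equiv> card (long_edges 0 (m - 1))"
    and "odds \<equiv> card {l \<in> polygons. odd (length l)}"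
    and "evens \<equiv> card {l \<in> polygons. even (length l)}"
  assumes "2 \<le> n"
  shows "2 * evens + n \<le> 2 * odds" "odds < evens + n" "n \<le> Suc evens"
proof -
  have "last l \<le> m - 1" if "l \<in> polygons" for l
    using that R_bound by (force simp: polygons_def)
  then have "num_polygons False 0 (m - 1) = odds" "num_polygons True 0 (m - 1) = evens"
    unfolding num_polygons_def odds_def evens_def by (auto intro!: arg_cong[of _ _ card])
  then show "2 * evens + n \<le> 2 * odds" "odds < evens + n" "n \<le> Suc evens"
    using interval_balanced[of 0 "m - 1"] m_ge_3 R_top \<open>2 \<le> n\<close>
    by (auto simp: n_def balanced_def split: if_splits)
qed

end

section \<open>Jordan curves in plane graphs\<close>

text \<open>A connected set with more than one point is perfect, and deleting two points does not
  affect limit points. Facts about open edges are passed on to whole edges in this way.\<close>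

lemma arc_endpoints_in_closure:
  fixes g :: "real \<Rightarrow> complex"
  assumes "arc g"
  shows "path_image g \<subseteq> closure (path_image g - {pathstart g, pathfinish g})"
proof -
  let ?a = "pathstart g" and ?b = "pathfinish g"
  let ?O = "path_image g - {?a, ?b}"
  have ne: "?a \<noteq> ?b" and ab: "?a \<in> path_image g" "?b \<in> path_image g"
    using arc_distinct_ends[OF assms] by auto
  have conn: "connected (path_image g)" using assms by (simp add: connected_arc_image)
  have "z islimpt ?O" if "z \<in> {?a, ?b}" for z
  proof -
    have "path_image g \<noteq> {w}" for w using ne ab by (metis singletonD)
    then have "z islimpt path_image g"
      using connected_imp_perfect[OF conn] that ab by simp (elim disjE; simp)
    moreover have "path_image g = insert ?a (insert ?b ?O)" using ab by auto
    ultimately have "z islimpt insert ?a (insert ?b ?O)" by simp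
    then show ?thesis unfolding islimpt_insert .
  qed
  then show ?thesis by (auto simp: closure_def)
qed

definition jordan_curve :: "complex set \<Rightarrow> bool" where
  "jordan_curve S \<longleftrightarrow> (\<exists>c. simple_path c \<and> pathfinish c = pathstart c \<and> path_image c = S)"

lemma jordan_curveD:
  assumes "jordan_curve S"
  shows "inside S \<noteq> {}" "open (inside S)" "connected (inside S)" "outside S \<noteq> {}"
    "open (outside S)" "connected (outside S)" "bounded (inside S)" "\<not> bounded (outside S)"
    "inside S \<inter> outside S = {}" "inside S \<union> outside S = - S" "frontier (inside S) = S"
    "compact S" "closure (inside S) = inside S \<union> S"
proof -
  obtain c where c: "simple_path c" "pathfinish c = pathstart c" "path_image c = S"
    using assms by (auto simp: jordan_curve_def)
  show *: "inside S \<noteq> {}" "open (inside S)" "connected (inside S)" "outside S \<noteq> {}"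
    "open (outside S)" "connected (outside S)" "bounded (inside S)" "\<not> bounded (outside S)"
    "inside S \<inter> outside S = {}" "inside S \<union> outside S = - S" "frontier (inside S) = S"
    using Jordan_inside_outside[OF c(1,2), unfolded c(3)] by simp_all
  show "compact S" using compact_simple_path_image[OF c(1)] c(3) by simp
  show "closure (inside S) = inside S \<union> S"
    unfolding closure_Un_frontier[of "inside S"] *(11) ..
qed

lemma jordan_curve_two_arcs:
  assumes "arc g1" "arc g2" "pathstart g1 = a" "pathfinish g1 = b"
    "pathstart g2 = a" "pathfinish g2 = b" "path_image g1 \<inter> path_image g2 = {a, b}"
  shows "jordan_curve (path_image g1 \<union> path_image g2)"
  unfolding jordan_curve_def
proof (intro exI conjI)
  show "simple_path (g1 +++ reversepath g2)"
    using assms by (intro simple_path_join_loop) (auto simp: arc_reversepath)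
qed (use assms in \<open>auto simp: path_image_join\<close>)

lemma connected_subset_inside:
  assumes "connected T" "T \<inter> S = {}" "T \<inter> inside S \<noteq> {}" "jordan_curve S"
  shows "T \<subseteq> inside S"
proof -
  have "T \<subseteq> inside S \<union> outside S" "inside S \<inter> outside S \<inter> T = {}"
    using jordan_curveD(9,10)[OF assms(4)] assms(2) by auto
  then have "T \<inter> outside S = {}"
    using connectedD[OF assms(1) jordan_curveD(2)[OF assms(4)] jordan_curveD(5)[OF assms(4)]]
      assms(3) by auto
  then show ?thesis using jordan_curveD(10)[OF assms(4)] assms(2) by blast
qed

lemma connected_subset_outside:
  assumes "connected T" "T \<inter> S = {}" "T \<inter> outside S \<noteq> {}" "jordan_curve S"
  shows "T \<subseteq> outside S"
  using connected_subset_inside[OF assms(1,2) _ assms(4)] jordan_curveD(9,10)[OF assms(4)] assms(2,3)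
  by blast

lemma open_arc_subset_inside:
  assumes "arc g" "jordan_curve S" "path_image g \<inter> S = {pathstart g, pathfinish g}"
    "path_image g \<inter> inside S \<noteq> {}"
  shows "path_image g - {pathstart g, pathfinish g} \<subseteq> inside S"
proof (rule connected_subset_inside)
  show "connected (path_image g - {pathstart g, pathfinish g})"
    using assms(1) by (simp add: arc_imp_simple_path connected_simple_path_endless)
  show "(path_image g - {pathstart g, pathfinish g}) \<inter> inside S \<noteq> {}"
    using assms(3,4) inside_no_overlap[of S] by blast
qed (use assms in auto)

text \<open>If no arc were inside the curve of the other two, then the inside of \<open>g\<^sub>2 \<union> g\<^sub>3\<close> would avoid
  the insides of \<open>g\<^sub>1 \<union> g\<^sub>2\<close> and \<open>g\<^sub>1 \<union> g\<^sub>3\<close>. By Janiszewski's theorem, applied to these two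
  curves, whose intersection \<open>g\<^sub>1\<close> is connected, its points could be joined to infinity without
  meeting any of the three arcs.\<close>

lemma theta_curve:
  fixes g1 g2 g3 :: "real \<Rightarrow> complex"
  assumes arcs: "arc g1" "arc g2" "arc g3"
    and ends: "pathstart g1 = a" "pathfinish g1 = b" "pathstart g2 = a" "pathfinish g2 = b"
      "pathstart g3 = a" "pathfinish g3 = b"
    and meet: "path_image g1 \<inter> path_image g2 = {a, b}" "path_image g1 \<inter> path_image g3 = {a, b}"
      "path_image g2 \<inter> path_image g3 = {a, b}"
  shows "path_image g3 - {a, b} \<subseteq> inside (path_image g1 \<union> path_image g2) \<or>
    path_image g2 - {a, b} \<subseteq> inside (path_image g1 \<union> path_image g3) \<or>
    path_image g1 - {a, b} \<subseteq> inside (path_image g2 \<union> path_image g3)"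
proof (rule ccontr)
  assume contr: "\<not> ?thesis"
  define A B C where "A = path_image g1" and "B = path_image g2" and "C = path_image g3"
  note defs = A_def[symmetric] B_def[symmetric] C_def[symmetric]
  have m: "A \<inter> B = {a, b}" "A \<inter> C = {a, b}" "B \<inter> C = {a, b}" using meet by (simp_all add: defs)
  have J: "jordan_curve (A \<union> B)" "jordan_curve (A \<union> C)" "jordan_curve (B \<union> C)"
    unfolding A_def B_def C_def
    using jordan_curve_two_arcs arcs ends meet by blast+
  have ne: "A - {a, b} \<noteq> {}" "B - {a, b} \<noteq> {}" "C - {a, b} \<noteq> {}"
    using nonempty_simple_path_endless[of g1] nonempty_simple_path_endless[of g2]
      nonempty_simple_path_endless[of g3] arcs ends by (auto simp: defs arc_imp_simple_path)
  have no: "C \<inter> inside (A \<union> B) = {}" "B \<inter> inside (A \<union> C) = {}" "A \<inter> inside (B \<union> C) = {}"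
  proof -
    have *: "X \<inter> inside S = {}"
      if "path_image g = X" "arc g" "pathstart g = a" "pathfinish g = b" "jordan_curve S"
        "X \<inter> S = {a, b}" "\<not> X - {a, b} \<subseteq> inside S" for g X S
      using open_arc_subset_inside[of g S] that by auto
    have X: "C \<inter> (A \<union> B) = {a, b}" "B \<inter> (A \<union> C) = {a, b}" "A \<inter> (B \<union> C) = {a, b}"
      using m by auto
    show "C \<inter> inside (A \<union> B) = {}" "B \<inter> inside (A \<union> C) = {}" "A \<inter> inside (B \<union> C) = {}"
      using *[OF C_def[symmetric] arcs(3) ends(5,6) J(1) X(1)]
        *[OF B_def[symmetric] arcs(2) ends(3,4) J(2) X(2)]
        *[OF A_def[symmetric] arcs(1) ends(1,2) J(3) X(3)] contr
      unfolding defs by simp_all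
  qed
  \<comment> \<open>If the inside of \<open>B \<union> C\<close> met that of
    \<open>A \<union> Y\<close>, it would be contained in it. Taking closures would place the
    remaining arc \<open>Z\<close> inside \<open>A \<union> Y\<close>, which was excluded.\<close>
  have sub: "inside (B \<union> C) \<subseteq> outside (A \<union> Y)"
    if Y: "Y = B \<and> Z = C \<or> Y = C \<and> Z = B" for Y Z
  proof -
    have JY: "jordan_curve (A \<union> Y)" using Y J by blast
    have dis: "inside (B \<union> C) \<inter> (A \<union> Y) = {}"
      using no(3) inside_no_overlap[of "B \<union> C"] Y by blast
    show ?thesis
    proof (rule ccontr)
      assume "\<not> ?thesis"
      then have "inside (B \<union> C) \<inter> inside (A \<union> Y) \<noteq> {}"
        using dis jordan_curveD(10)[OF JY] by blast
      then have "inside (B \<union> C) \<subseteq> inside (A \<union> Y)"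
        using connected_subset_inside[OF jordan_curveD(3)[OF J(3)] dis _ JY] by blast
      then have "closure (inside (B \<union> C)) \<subseteq> closure (inside (A \<union> Y))" by (rule closure_mono)
      then have "Z - {a, b} \<subseteq> inside (A \<union> Y) \<union> (A \<union> Y)"
        using Y jordan_curveD(13)[OF J(3)] jordan_curveD(13)[OF JY] by blast
      then have "Z - {a, b} \<subseteq> inside (A \<union> Y)" using Y m by blast
      then show False using Y no ne by blast
    qed
  qed
  obtain x where x: "x \<in> inside (B \<union> C)" using jordan_curveD(1)[OF J(3)] by blast
  \<comment> \<open>This supplies a point \<open>y\<close> beyond all three curves, to which
    \<open>x\<close> is then joined.\<close>
  have "bounded (inside (A \<union> B) \<union> inside (A \<union> C) \<union> inside (B \<union> C) \<union> (A \<union> B) \<union> (B \<union> C))" (is "bounded ?U")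
    using J[THEN jordan_curveD(7)] J(1,3)[THEN jordan_curveD(12), THEN compact_imp_bounded] by simp
  then have "?U \<noteq> UNIV" using not_bounded_UNIV by metis
  then obtain y where y: "y \<notin> ?U" by blast
  have out: "connected_component (- (A \<union> Y)) x y" if Y: "Y = B \<or> Y = C" for Y
    unfolding connected_component_def
  proof (intro exI conjI)
    have JY: "jordan_curve (A \<union> Y)" using J Y by blast
    show "connected (outside (A \<union> Y))" using jordan_curveD(6)[OF JY] .
    show "outside (A \<union> Y) \<subseteq> - (A \<union> Y)" using jordan_curveD(10)[OF JY] by blast
    show "x \<in> outside (A \<union> Y)" using sub Y x by blast
    show "y \<in> outside (A \<union> Y)" using jordan_curveD(10)[OF JY] y Y by blast
  qed
  have "connected ((A \<union> B) \<inter> (A \<union> C))"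
  proof -
    have "(A \<union> B) \<inter> (A \<union> C) = A" using m by blast
    then show ?thesis using arcs(1) by (simp add: A_def connected_arc_image)
  qed
  then have "connected_component (- ((A \<union> B) \<union> (A \<union> C))) x y"
    using Janiszewski[of "A \<union> B" "A \<union> C" x y] jordan_curveD(12) J out
    by (auto intro: compact_imp_closed)
  then obtain T where T: "connected T" "T \<subseteq> - (A \<union> B \<union> C)" "x \<in> T" "y \<in> T"
    by (auto simp: connected_component_def)
  then have "T \<subseteq> inside (B \<union> C)"
    using connected_subset_inside[of T "B \<union> C"] x J(3) by blast
  then show False using T y by blast
qed

section \<open>Paths and cycles of a plane graph as arcs and Jordan curves\<close>

locale plane_graph =
  fixes V :: "'a set" and E :: "'a set set"
    and pos :: "'a \<Rightarrow> complex" and crv :: "'a set \<Rightarrow> real \<Rightarrow> complex"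
  assumes simple: "simple_graph V E" and embedding: "plane_embedding V E pos crv"
begin

definition img :: "'a set set \<Rightarrow> complex set" where
  "img A = (\<Union>e\<in>A. path_image (crv e))"

lemma edgeD: "e \<in> E \<Longrightarrow> e \<subseteq> V \<and> card e = 2"
  using simple by (auto simp: simple_graph_def)

lemma finite_E: "finite E"
  using simple by (intro finite_subset[of E "Pow V"]) (auto simp: simple_graph_def)

lemma edge_arc:
  assumes "e \<in> E"
  shows "arc (crv e)" "{pathstart (crv e), pathfinish (crv e)} = pos ` e"
    "path_image (crv e) \<inter> pos ` V = pos ` e"
  using assms embedding by (auto simp: plane_embedding_def)

lemma edge_inter: "e \<in> E \<Longrightarrow> e' \<in> E \<Longrightarrow> e \<noteq> e' \<Longrightarrow>
    path_image (crv e) \<inter> path_image (crv e') = pos ` (e \<inter> e')"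
  using embedding by (auto simp: plane_embedding_def)

lemma pos_eq_iff: "u \<in> V \<Longrightarrow> v \<in> V \<Longrightarrow> pos u = pos v \<longleftrightarrow> u = v"
  using embedding by (auto simp: plane_embedding_def inj_on_def)

lemma img_Un: "img (A \<union> B) = img A \<union> img B"
  by (auto simp: img_def)

lemma img_inter:
  assumes "A \<subseteq> E" "B \<subseteq> E" "A \<inter> B = {}"
  shows "img A \<inter> img B = pos ` (\<Union>A \<inter> \<Union>B)"
proof -
  have "img A \<inter> img B = (\<Union>e\<in>A. \<Union>e'\<in>B. path_image (crv e) \<inter> path_image (crv e'))"
    by (auto simp: img_def)
  also have "\<dots> = (\<Union>e\<in>A. \<Union>e'\<in>B. pos ` (e \<inter> e'))"
    using edge_inter assms by (intro SUP_cong) (auto simp: disjoint_iff; blast)+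
  also have "\<dots> = pos ` (\<Union>A \<inter> \<Union>B)"
    by auto
  finally show ?thesis .
qed

lemma pos_in_img_iff:
  assumes "A \<subseteq> E" "v \<in> V"
  shows "pos v \<in> img A \<longleftrightarrow> v \<in> \<Union>A"
proof -
  have "pos v \<in> path_image (crv e) \<longleftrightarrow> v \<in> e" if "e \<in> A" for e
  proof -
    have e: "e \<in> E" "e \<subseteq> V" using that assms edgeD by auto
    have "pos v \<in> path_image (crv e) \<longleftrightarrow> pos v \<in> pos ` e"
      using edge_arc(3)[OF e(1)] assms(2) by blast
    also have "\<dots> \<longleftrightarrow> v \<in> e" using pos_eq_iff assms(2) e(2) by blast
    finally show ?thesis .
  qed
  then show ?thesis by (auto simp: img_def)
qed

lemma edge_ends_in_closure: "e \<in> E \<Longrightarrow> path_image (crv e) \<subseteq> closure (path_image (crv e) - pos ` e)"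
  using arc_endpoints_in_closure edge_arc by metis

lemma connected_open_edge: "e \<in> E \<Longrightarrow> connected (path_image (crv e) - pos ` e)"
  using connected_simple_path_endless[of "crv e"] arc_imp_simple_path edge_arc(1,2) by metis

lemma open_edge_nonempty: "e \<in> E \<Longrightarrow> path_image (crv e) - pos ` e \<noteq> {}"
  using nonempty_simple_path_endless[of "crv e"] arc_imp_simple_path edge_arc(1,2) by metis

lemma open_edge_disjoint_img:
  assumes "e \<in> E" "A \<subseteq> E" "e \<notin> A"
  shows "(path_image (crv e) - pos ` e) \<inter> img A = {}"
  using img_inter[of "{e}" A] assms by (auto simp: img_def)

lemma edge_oriented_arc:
  assumes "{x, y} \<in> E"
  obtains g where "arc g" "pathstart g = pos x" "pathfinish g = pos y"
    "path_image g = path_image (crv {x, y})"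
proof -
  have *: "{pathstart (crv {x, y}), pathfinish (crv {x, y})} = {pos x, pos y}"
    using edge_arc(2)[OF assms] by simp
  show ?thesis
  proof (cases "pathstart (crv {x, y}) = pos x")
    case True
    then show ?thesis using that[of "crv {x, y}"] * edge_arc(1)[OF assms]
      by (auto simp: doubleton_eq_iff)
  next
    case False
    then show ?thesis using that[of "reversepath (crv {x, y})"] * edge_arc(1)[OF assms]
      by (auto simp: doubleton_eq_iff arc_reversepath)
  qed
qed

lemma path_arc:
  assumes "distinct p" "length p \<ge> 2" "set (path_edges p) \<subseteq> E"
  shows "\<exists>g. arc g \<and> pathstart g = pos (hd p) \<and> pathfinish g = pos (last p) \<and>
    path_image g = img (set (path_edges p))"
  using assms
proof (induction p rule: path_edges.induct)
  case (1 x y r)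
  obtain g where g: "arc g" "pathstart g = pos x" "pathfinish g = pos y"
    "path_image g = path_image (crv {x, y})"
    using edge_oriented_arc[of x y] 1 by auto
  show ?case
  proof (cases r)
    case Nil
    then show ?thesis using g by (intro exI[of _ g]) (auto simp: img_def)
  next
    case (Cons z r')
    then obtain g' where g': "arc g'" "pathstart g' = pos y" "pathfinish g' = pos (last r)"
      "path_image g' = img (set (path_edges (y # r)))"
      using 1 by auto
    have "{x, y} \<notin> set (path_edges (y # r))"
      using 1(2) path_edges_subset[of "{x, y}" "y # r"] by auto
    then have "path_image g \<inter> path_image g' = pos ` ({x, y} \<inter> \<Union> (set (path_edges (y # r))))"
      using img_inter[of "{{x, y}}" "set (path_edges (y # r))"] 1(4)
      by (simp add: g(4) g'(4) img_def)
    also have "\<dots> \<subseteq> {pos y}"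
      using 1(2) Cons by (subst Union_path_edges) auto
    finally have "arc (g +++ g')" using arc_join[OF g(1) g'(1)] g g' by auto
    then show ?thesis
      using g g' Cons by (intro exI[of _ "g +++ g'"]) (auto simp: path_image_join img_def)
  qed
qed auto

text \<open>A path is given by its inner vertices, so paths with common ends are internally disjoint
  when these lists are. A cycle through \<open>x\<close> and \<open>y\<close> is a union of two such
  sets, one of the lists being reversed.\<close>

definition between :: "'a \<Rightarrow> 'a list \<Rightarrow> 'a \<Rightarrow> 'a set set" where
  "between x xs y = set (path_edges (x # xs @ [y]))"

lemma Union_between: "\<Union> (between x xs y) = {x, y} \<union> set xs"
  unfolding between_def by (subst Union_path_edges) auto

lemma between_Nil [simp]: "between x [] y = {{x, y}}"
  by (simp add: between_def)

lemma between_rev: "between y (rev xs) x = between x xs y"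
  using path_edges_rev[of "x # xs @ [y]"] by (simp add: between_def)

text \<open>A common edge could only be \<open>{x, y}\<close>, and a simple path containing the edge
  between its ends has no inner vertices.\<close>

lemma between_disjoint:
  assumes "distinct (x # xs @ [y])" "distinct (x # ys @ [y])" "set xs \<inter> set ys = {}"
    "xs \<noteq> [] \<or> ys \<noteq> []" "between x xs y \<subseteq> E"
  shows "between x xs y \<inter> between x ys y = {}"
proof (rule ccontr)
  assume "\<not> ?thesis"
  then obtain e where e: "e \<in> between x xs y" "e \<in> between x ys y" by blast
  then have "e \<subseteq> ({x, y} \<union> set xs) \<inter> ({x, y} \<union> set ys)"
    using Union_between[of x xs y] Union_between[of x ys y] by blast
  then have "e \<subseteq> {x, y}" using assms(3) by blast
  moreover have "card e = 2" using e assms(5) edgeD by blast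
  ultimately have "e = {x, y}" using card_subset_eq[of "{x, y}" e] assms(1) by simp
  then show False using e assms edge_between_ends unfolding between_def by metis
qed

lemma between_arc:
  assumes "distinct (x # xs @ [y])" "between x xs y \<subseteq> E"
  obtains g where "arc g" "pathstart g = pos x" "pathfinish g = pos y" "path_image g = img (between x xs y)"
  using path_arc[of "x # xs @ [y]"] assms that by (auto simp: between_def)

lemma between_img_inter:
  assumes "distinct (x # xs @ [y])" "distinct (x # ys @ [y])" "set xs \<inter> set ys = {}"
    "xs \<noteq> [] \<or> ys \<noteq> []" "between x xs y \<subseteq> E" "between x ys y \<subseteq> E"
  shows "img (between x xs y) \<inter> img (between x ys y) = {pos x, pos y}"
proof -
  have "({x, y} \<union> set xs) \<inter> ({x, y} \<union> set ys) = {x, y}" using assms(3) by blast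
  then show ?thesis
    using img_inter[OF assms(5,6) between_disjoint[OF assms(1-5)]] by (simp add: Union_between)
qed

definition is_cycle :: "'a list \<Rightarrow> bool" where
  "is_cycle p \<longleftrightarrow> distinct p \<and> length p \<ge> 3 \<and> set (closed_walk_edges p) \<subseteq> E"

definition curve :: "'a list \<Rightarrow> complex set" where
  "curve p = img (set (closed_walk_edges p))"

definition chords :: "'a list \<Rightarrow> 'a set set" where
  "chords p = {e \<in> E. e \<subseteq> set p} - set (closed_walk_edges p)"

lemma cycle_split: "set (closed_walk_edges (x # xs @ y # ys)) = between x xs y \<union> between x (rev ys) y"
  using set_closed_walk_edges_split[of x xs y ys] between_rev[of x ys y] by (simp add: between_def)

lemma is_cycle_vertices:
  assumes "is_cycle p"
  shows "set p \<subseteq> V"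
  using assms Union_closed_walk_edges[of p] edgeD unfolding is_cycle_def by blast

lemma jordan_curve_cycle:
  assumes "is_cycle p"
  shows "jordan_curve (curve p)"
proof -
  obtain x y ys where p: "p = x # [] @ y # ys" using assms
    by (cases p; cases "tl p") (auto simp: is_cycle_def)
  have d: "distinct (x # [] @ [y])" "distinct (x # rev ys @ [y])" "ys \<noteq> []"
    using assms p by (auto simp: is_cycle_def)
  have e: "between x [] y \<subseteq> E" "between x (rev ys) y \<subseteq> E"
    using assms cycle_split[of x "[]" y ys] unfolding p is_cycle_def by blast+
  obtain g1 where g1: "arc g1" "pathstart g1 = pos x" "pathfinish g1 = pos y"
    "path_image g1 = img (between x [] y)" using between_arc[OF d(1) e(1)] .
  obtain g2 where g2: "arc g2" "pathstart g2 = pos x" "pathfinish g2 = pos y"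
    "path_image g2 = img (between x (rev ys) y)" using between_arc[OF d(2) e(2)] .
  have "path_image g1 \<inter> path_image g2 = {pos x, pos y}"
    unfolding g1 g2 using d e by (intro between_img_inter) auto
  then have "jordan_curve (path_image g1 \<union> path_image g2)"
    using jordan_curve_two_arcs g1 g2 by blast
  moreover have "curve p = path_image g1 \<union> path_image g2"
    unfolding curve_def p cycle_split g1 g2 img_Un ..
  ultimately show ?thesis by simp
qed

lemma drawing_eq: "drawing V E pos crv = pos ` V \<union> img E"
  by (simp add: drawing_def img_def)

end

locale outerplane_graph = plane_graph +
  assumes outer: "all_vertices_on_infinite_face V E pos crv"
begin

text \<open>The inside is open, so a vertex in it, being on the frontier of the infinite face, would
  make that face enter the inside. The face is connected and avoids the edges, so it would lie in a
  bounded component.\<close>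

lemma vertex_not_inside:
  assumes "v \<in> V" "A \<subseteq> E"
  shows "pos v \<notin> inside (img A)"
proof
  assume v: "pos v \<in> inside (img A)"
  obtain f where f: "f \<in> faces V E pos crv" "\<not> bounded f" "pos ` V \<subseteq> frontier f"
    using outer by (auto simp: all_vertices_on_infinite_face_def)
  have conn: "connected f" and sub: "f \<subseteq> - img A"
    using f(1) assms(2) in_components_connected in_components_subset
    unfolding faces_def drawing_eq by (auto simp: img_def) blast+
  have "closed (img A)"
    using assms finite_subset[OF _ finite_E] edge_arc(1)
    unfolding img_def by (intro closed_UN) (auto intro: closed_arc_image)
  then have "open (inside (img A))" by (rule open_inside)
  moreover have "pos v \<in> closure f" using f(3) assms(1) by (auto simp: frontier_def)
  ultimately obtain x where x: "x \<in> f" "x \<in> inside (img A)"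
    using v by (metis disjoint_iff open_Int_closure_eq_empty)
  have "f \<subseteq> connected_component_set (- img A) x"
    using connected_component_maximal[OF x(1) conn sub] .
  then have "bounded f" using x(2) by (auto simp: inside_def intro: bounded_subset)
  then show False using f(2) by simp
qed

text \<open>By the theta curve lemma one of the three paths runs inside the curve of the other two,
  and a path that does so has no inner vertices. This singles out the third path. The first
  conclusion rules out ears, the second places chords.\<close>

lemma theta_chord:
  assumes d: "distinct (x # xs @ [y])" "distinct (x # ys @ [y])" "distinct (x # zs @ [y])"
    and dis: "set xs \<inter> set ys = {}" "set xs \<inter> set zs = {}" "set ys \<inter> set zs = {}"
    and e: "between x xs y \<subseteq> E" "between x ys y \<subseteq> E" "between x zs y \<subseteq> E"
    and ne: "xs \<noteq> []" "ys \<noteq> []"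
  shows "zs = []"
    "path_image (crv {x, y}) - pos ` {x, y} \<subseteq> inside (img (between x xs y \<union> between x ys y))"
proof -
  obtain g1 where g1: "arc g1" "pathstart g1 = pos x" "pathfinish g1 = pos y"
    "path_image g1 = img (between x xs y)" using between_arc[OF d(1) e(1)] .
  obtain g2 where g2: "arc g2" "pathstart g2 = pos x" "pathfinish g2 = pos y"
    "path_image g2 = img (between x ys y)" using between_arc[OF d(2) e(2)] .
  obtain g3 where g3: "arc g3" "pathstart g3 = pos x" "pathfinish g3 = pos y"
    "path_image g3 = img (between x zs y)" using between_arc[OF d(3) e(3)] .
  have "path_image g1 \<inter> path_image g2 = {pos x, pos y}"
    "path_image g1 \<inter> path_image g3 = {pos x, pos y}"
    "path_image g2 \<inter> path_image g3 = {pos x, pos y}"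
    unfolding g1 g2 g3 using d e ne dis by (intro between_img_inter; simp)+
  from theta_curve[OF g1(1) g2(1) g3(1) g1(2,3) g2(2,3) g3(2,3) this]
  have cases: "img (between x zs y) - {pos x, pos y} \<subseteq> inside (img (between x xs y \<union> between x ys y)) \<or>
     img (between x ys y) - {pos x, pos y} \<subseteq> inside (img (between x xs y \<union> between x zs y)) \<or>
     img (between x xs y) - {pos x, pos y} \<subseteq> inside (img (between x ys y \<union> between x zs y))"
    by (simp add: g1 g2 g3 img_Un)
  have no: False if sub: "img (between x ws y) - {pos x, pos y} \<subseteq> inside (img A)" and
      w: "ws \<noteq> []" "distinct (x # ws @ [y])" "between x ws y \<subseteq> E" "A \<subseteq> E" for ws A
  proof -
    have verts: "{x, y} \<union> set ws \<subseteq> V"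
      using Union_between[of x ws y] edgeD w(3) by blast
    have w0: "hd ws \<in> set ws" using w(1) by simp
    then have "hd ws \<in> V" "hd ws \<noteq> x" "hd ws \<noteq> y" using verts w(2) by auto
    moreover from this have "pos (hd ws) \<noteq> pos x" "pos (hd ws) \<noteq> pos y"
      using verts pos_eq_iff by auto
    moreover have "pos (hd ws) \<in> img (between x ws y)"
      using pos_in_img_iff[OF w(3)] \<open>hd ws \<in> V\<close> w0 Union_between[of x ws y] by blast
    ultimately show False using sub vertex_not_inside[OF _ w(4)] by blast
  qed
  have *: "img (between x zs y) - {pos x, pos y} \<subseteq> inside (img (between x xs y \<union> between x ys y))"
    using cases no[of ys] no[of xs] d e ne by blast
  then show "zs = []" using no[of zs] d e by blast
  then show "path_image (crv {x, y}) - pos ` {x, y} \<subseteq> inside (img (between x xs y \<union> between x ys y))"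
    using * by (simp add: img_def)
qed

end

section \<open>Faces inside a cycle\<close>

text \<open>Colouring the vertices of an even cycle by the parity of their index is proper, also
  across the closing edge; a closed walk along its edges alternates between the two colours.\<close>

lemma closed_walk_parity:
  assumes q: "distinct q" "even (length q)"
    and sub: "set (closed_walk_edges p) \<subseteq> set (closed_walk_edges q)"
  shows "even (length p)"
proof (cases "p = []")
  case False
  define col where "col v \<longleftrightarrow> (\<exists>i<length q. q ! i = v \<and> even i)" for v
  have col: "col (q ! i) \<longleftrightarrow> even i" if "i < length q" for i
    using that q(1) nth_eq_iff_index_eq by (fastforce simp: col_def)
  have alt: "col x \<noteq> col y" if "{x, y} \<in> set (closed_walk_edges q)" for x y
  proof -
    obtain i where i: "i < length q" "{x, y} = {q ! i, q ! (Suc i mod length q)}"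
      using \<open>{x, y} \<in> _\<close> by (auto simp: closed_walk_edges_def)
    have "even (Suc i mod length q) \<longleftrightarrow> odd i" using q(2) by (simp add: dvd_mod_iff)
    moreover have "Suc i mod length q < length q" using i(1) by (intro mod_less_divisor) auto
    ultimately have "col (q ! i) \<noteq> col (q ! (Suc i mod length q))" using col i(1) by simp
    then show ?thesis using i(2) by (auto simp: doubleton_eq_iff)
  qed
  have step: "col (p ! i) \<noteq> col (p ! (Suc i mod length p))" if "i < length p" for i
    using that sub by (intro alt) (auto simp: closed_walk_edges_def)
  have "col (p ! i) \<longleftrightarrow> (even i \<longleftrightarrow> col (p ! 0))" if "i < length p" for i
    using that
  proof (induction i)
    case (Suc i)
    then show ?case using step[of i] by auto
  qed simp
  from this[of "length p - 1"] step[of "length p - 1"] show ?thesis using False by auto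
qed simp

context plane_graph
begin

definition faces_within :: "'a list \<Rightarrow> complex set set" where
  "faces_within p = {f \<in> faces V E pos crv. f \<subseteq> inside (curve p)}"

lemma is_cycle_cong:
  assumes "is_cycle p" "distinct q" "set q = set p" "length q = length p"
    "set (closed_walk_edges q) = set (closed_walk_edges p)"
  shows "is_cycle q" "curve q = curve p" "chords q = chords p" "faces_within q = faces_within p"
  using assms by (auto simp: is_cycle_def curve_def chords_def faces_within_def)

lemma obtain_chord_split:
  assumes "is_cycle p" "e \<in> chords p"
  obtains x xs y ys where "e = {x, y}" "xs \<noteq> []" "ys \<noteq> []" "distinct (x # xs @ y # ys)"
    "set (x # xs @ y # ys) = set p" "length (x # xs @ y # ys) = length p"
    "set (closed_walk_edges (x # xs @ y # ys)) = set (closed_walk_edges p)"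
proof -
  have e: "e \<in> E" "e \<subseteq> set p" "e \<notin> set (closed_walk_edges p)"
    using assms(2) by (auto simp: chords_def)
  obtain x y where xy: "e = {x, y}" "x \<noteq> y"
    using edgeD[OF e(1)] by (auto simp: card_2_iff)
  have "distinct p" "x \<in> set p" "y \<in> set p" using assms(1) e xy by (auto simp: is_cycle_def)
  from obtain_rotation[OF this xy(2)] obtain xs ys where
    q: "distinct (x # xs @ y # ys)" "set (x # xs @ y # ys) = set p"
    "set (closed_walk_edges (x # xs @ y # ys)) = set (closed_walk_edges p)"
    "length (x # xs @ y # ys) = length p" .
  have "xs \<noteq> []" "ys \<noteq> []"
    using e(3) unfolding q(3)[symmetric] cycle_split xy by (auto simp: insert_commute)
  then show ?thesis using that xy(1) q by blast
qed

lemma cycle_halves: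
  assumes "is_cycle (x # xs @ y # ys)" "xs \<noteq> []" "ys \<noteq> []" "{x, y} \<in> E"
  shows "is_cycle (x # xs @ [y])" "is_cycle (y # ys @ [x])"
    "set (closed_walk_edges (x # xs @ [y])) = insert {x, y} (between x xs y)"
    "set (closed_walk_edges (y # ys @ [x])) = insert {x, y} (between x (rev ys) y)"
proof -
  show 1: "set (closed_walk_edges (x # xs @ [y])) = insert {x, y} (between x xs y)"
    using cycle_split[of x xs y "[]"] by auto
  show 2: "set (closed_walk_edges (y # ys @ [x])) = insert {x, y} (between x (rev ys) y)"
    using cycle_split[of y ys x "[]"] between_rev[of x ys y] by (auto simp: insert_commute)
  show "is_cycle (x # xs @ [y])" "is_cycle (y # ys @ [x])"
    using assms(1) cycle_split[of x xs y ys] assms(2-4)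
    unfolding is_cycle_def 1 2 by (auto simp: Suc_le_eq)
qed

end

context outerplane_graph
begin

lemma chord_inside:
  assumes "is_cycle p" "e \<in> chords p"
  shows "path_image (crv e) - pos ` e \<subseteq> inside (curve p)"
proof -
  obtain x xs y ys where q: "e = {x, y}" "xs \<noteq> []" "ys \<noteq> []" "distinct (x # xs @ y # ys)"
    "set (closed_walk_edges (x # xs @ y # ys)) = set (closed_walk_edges p)"
    using obtain_chord_split[OF assms] by metis
  have e: "between x xs y \<subseteq> E" "between x (rev ys) y \<subseteq> E" "{x, y} \<in> E"
    using assms q(1,5) cycle_split[of x xs y ys] by (auto simp: is_cycle_def chords_def)
  have "path_image (crv {x, y}) - pos ` {x, y}
      \<subseteq> inside (img (between x xs y \<union> between x (rev ys) y))"
    using q e by (intro theta_chord(2)[where zs = "[]"]) auto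
  then show ?thesis using q(1,5) cycle_split[of x xs y ys] by (simp add: curve_def)
qed

lemma vertex_not_inside_cycle:
  assumes "is_cycle p" "v \<in> V"
  shows "pos v \<notin> inside (curve p)"
  using vertex_not_inside assms by (simp add: curve_def is_cycle_def)

text \<open>The open part of an edge off the cycle cannot leave the inside, so its ends lie in the
  closure of the inside; as they are vertices, they lie on the curve.\<close>

lemma edge_meeting_inside:
  assumes p: "is_cycle p" and e: "e \<in> E" and meet: "path_image (crv e) \<inter> inside (curve p) \<noteq> {}"
  shows "e \<subseteq> set p"
proof (cases "e \<in> set (closed_walk_edges p)")
  case True
  then show ?thesis by (rule closed_walk_edges_subset)
next
  case False
  note J = jordan_curve_cycle[OF p]
  let ?U = "path_image (crv e) - pos ` e"
  have sub: "set (closed_walk_edges p) \<subseteq> E" using p by (simp add: is_cycle_def)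
  obtain z where "z \<in> closure ?U" "z \<in> inside (curve p)"
    using meet edge_ends_in_closure[OF e] by blast
  then have "?U \<inter> inside (curve p) \<noteq> {}"
    using open_Int_closure_eq_empty[OF jordan_curveD(2)[OF J], of ?U] by blast
  moreover have "?U \<inter> curve p = {}"
    unfolding curve_def using open_edge_disjoint_img[OF e sub False] .
  ultimately have "?U \<subseteq> inside (curve p)"
    using connected_subset_inside[OF connected_open_edge[OF e] _ _ J] by blast
  then have "path_image (crv e) \<subseteq> inside (curve p) \<union> curve p"
    using closure_mono[of ?U "inside (curve p)"] edge_ends_in_closure[OF e] jordan_curveD(13)[OF J]
    by blast
  moreover have "pos ` e \<subseteq> path_image (crv e)" using edge_arc(3)[OF e] by blast
  ultimately have *: "pos ` e \<subseteq> inside (curve p) \<union> curve p" by blast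
  show ?thesis
  proof
    fix v assume v: "v \<in> e"
    then have "v \<in> V" using edgeD[OF e] by blast
    then have "pos v \<in> img (set (closed_walk_edges p))"
      using * v vertex_not_inside_cycle[OF p] by (auto simp: curve_def)
    then show "v \<in> set p"
      using pos_in_img_iff[OF sub \<open>v \<in> V\<close>] Union_closed_walk_edges[of p] by simp
  qed
qed

text \<open>The chord and the two parts of the cycle form a theta curve whose middle arc is the
  chord, by \<open>chord_inside\<close>.\<close>

lemma inside_halves:
  assumes p: "is_cycle (x # xs @ y # ys)" and ne: "xs \<noteq> []" "ys \<noteq> []" and xy: "{x, y} \<in> E"
  shows "inside (curve (x # xs @ [y])) \<inter> inside (curve (y # ys @ [x])) = {}"
    "inside (curve (x # xs @ [y])) \<union> inside (curve (y # ys @ [x])) \<union>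
      (path_image (crv {x, y}) - pos ` {x, y}) = inside (curve (x # xs @ y # ys))"
proof -
  have d: "distinct (x # xs @ [y])" "distinct (x # rev ys @ [y])" "distinct (x # [] @ [y])"
    "set xs \<inter> set (rev ys) = {}"
    using p by (auto simp: is_cycle_def)
  have e: "between x xs y \<subseteq> E" "between x (rev ys) y \<subseteq> E" "between x [] y \<subseteq> E"
    using p xy cycle_split[of x xs y ys] by (auto simp: is_cycle_def)
  obtain g1 where g1: "arc g1" "pathstart g1 = pos x" "pathfinish g1 = pos y"
    "path_image g1 = img (between x xs y)" using between_arc[OF d(1) e(1)] .
  obtain g2 where g2: "arc g2" "pathstart g2 = pos x" "pathfinish g2 = pos y"
    "path_image g2 = img (between x (rev ys) y)" using between_arc[OF d(2) e(2)] .
  obtain g3 where g3: "arc g3" "pathstart g3 = pos x" "pathfinish g3 = pos y"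
    "path_image g3 = img (between x [] y)" using between_arc[OF d(3) e(3)] .
  have meet: "path_image g1 \<inter> path_image g2 = {pos x, pos y}"
    "path_image g1 \<inter> path_image g3 = {pos x, pos y}"
    "path_image g2 \<inter> path_image g3 = {pos x, pos y}"
    unfolding g1 g2 g3 using d e ne by (intro between_img_inter; simp)+
  have c: "path_image g1 \<union> path_image g2 = curve (x # xs @ y # ys)"
    "path_image g1 \<union> path_image g3 = curve (x # xs @ [y])"
    "path_image g2 \<union> path_image g3 = curve (y # ys @ [x])"
    using cycle_halves(3,4)[OF p ne xy] cycle_split[of x xs y ys]
    by (auto simp: curve_def g1 g2 g3 img_def)
  have g3': "path_image g3 = path_image (crv {x, y})" by (simp add: g3 img_def)
  have "{x, y} \<in> chords (x # xs @ y # ys)"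
  proof -
    have "{x, y} \<notin> between x xs y" "{x, y} \<notin> between x (rev ys) y"
      using d ne edge_between_ends[of x xs y] edge_between_ends[of x "rev ys" y]
      by (auto simp: between_def)
    then show ?thesis using xy cycle_split[of x xs y ys] by (auto simp: chords_def)
  qed
  then have "path_image (crv {x, y}) - pos ` {x, y} \<subseteq> inside (curve (x # xs @ y # ys))"
    using chord_inside[OF p] by blast
  then have "path_image g3 \<inter> inside (path_image g1 \<union> path_image g2) \<noteq> {}"
    using open_edge_nonempty[OF xy] unfolding c g3' by blast
  moreover have "pos x \<noteq> pos y" using arc_distinct_ends[OF g1(1)] g1(2,3) by metis
  ultimately show "inside (curve (x # xs @ [y])) \<inter> inside (curve (y # ys @ [x])) = {}"
    "inside (curve (x # xs @ [y])) \<union> inside (curve (y # ys @ [x])) \<union>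
      (path_image (crv {x, y}) - pos ` {x, y}) = inside (curve (x # xs @ y # ys))"
    using split_inside_simple_closed_curve[OF arc_imp_simple_path[OF g1(1)] g1(2,3)
      arc_imp_simple_path[OF g2(1)] g2(2,3) arc_imp_simple_path[OF g3(1)] g3(2,3) _ meet]
    unfolding c by (auto simp: g3')
qed

text \<open>The chord \<open>{u, v}\<close> runs inside the cycle and is disjoint from
  \<open>{x, y}\<close>, so it meets the inside of one half; then both its ends would belong to that
  half.\<close>

lemma chords_do_not_cross:
  assumes p: "is_cycle (x # xs @ y # ys)" and xy: "{x, y} \<in> E" and uv: "{u, v} \<in> E"
    "u \<in> set xs" "v \<in> set ys"
  shows False
proof -
  have ne: "xs \<noteq> []" "ys \<noteq> []" using uv by auto
  have d: "distinct (x # xs @ y # ys)" using p by (simp add: is_cycle_def)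
  have not_sub: "\<not> {u, v} \<subseteq> set (x # xs @ [y])" "\<not> {u, v} \<subseteq> set (y # ys @ [x])"
    using d uv by auto
  have "{u, v} \<notin> set (closed_walk_edges (x # xs @ y # ys))"
  proof -
    have "{u, v} \<notin> between x xs y" "{u, v} \<notin> between x (rev ys) y"
      using Union_between[of x xs y] Union_between[of x "rev ys" y] not_sub by fastforce+
    then show ?thesis unfolding cycle_split by blast
  qed
  then have "{u, v} \<in> chords (x # xs @ y # ys)" using uv by (auto simp: chords_def)
  then have "path_image (crv {u, v}) - pos ` {u, v} \<subseteq> inside (curve (x # xs @ y # ys))"
    using chord_inside[OF p] by blast
  moreover have "{u, v} \<inter> {x, y} = {}" using d uv by auto
  then have "path_image (crv {u, v}) \<inter> path_image (crv {x, y}) = {}"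
    using edge_inter[OF uv(1) xy] by auto
  ultimately have "path_image (crv {u, v}) - pos ` {u, v} \<subseteq>
      inside (curve (x # xs @ [y])) \<union> inside (curve (y # ys @ [x]))"
    using inside_halves(2)[OF p ne xy] by blast
  then have "path_image (crv {u, v}) \<inter> inside (curve (x # xs @ [y])) \<noteq> {} \<or>
      path_image (crv {u, v}) \<inter> inside (curve (y # ys @ [x])) \<noteq> {}"
    using open_edge_nonempty[OF uv(1)] by blast
  then show False
    using edge_meeting_inside[OF _ uv(1)] cycle_halves(1,2)[OF p ne xy] not_sub by blast
qed

lemma faceD:
  assumes "f \<in> faces V E pos crv"
  shows "connected f" "f \<noteq> {}" "f \<inter> img E = {}"
    "\<And>d. connected d \<Longrightarrow> d \<inter> drawing V E pos crv = {} \<Longrightarrow> f \<subseteq> d \<Longrightarrow> d = f"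
proof -
  have f: "f \<noteq> {}" "f \<subseteq> - drawing V E pos crv" "connected f"
    and max: "\<And>d. d \<noteq> {} \<Longrightarrow> f \<subseteq> d \<Longrightarrow> d \<subseteq> - drawing V E pos crv \<Longrightarrow> connected d \<Longrightarrow> d = f"
    using assms unfolding faces_def in_components_maximal by auto
  show "connected f" "f \<noteq> {}" by fact+
  show "f \<inter> img E = {}" using f(2) by (auto simp: drawing_eq)
  show "d = f" if "connected d" "d \<inter> drawing V E pos crv = {}" "f \<subseteq> d" for d
    using that f(1) by (intro max) auto
qed

lemma faceI:
  assumes "connected S" "S \<noteq> {}" "S \<inter> drawing V E pos crv = {}"
    "\<And>d. connected d \<Longrightarrow> d \<inter> drawing V E pos crv = {} \<Longrightarrow> d \<inter> S \<noteq> {} \<Longrightarrow> d \<subseteq> S"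
  shows "S \<in> faces V E pos crv"
  unfolding faces_def in_components_maximal
proof (intro conjI allI impI)
  fix d assume d: "d \<noteq> {} \<and> S \<subseteq> d \<and> d \<subseteq> - drawing V E pos crv \<and> connected d"
  then have "d \<subseteq> S" using assms(2) by (intro assms(4)) auto
  then show "d = S" using d by blast
qed (use assms in auto)

lemma chordless_cycle_face:
  assumes p: "is_cycle p" and "chords p = {}"
  shows "inside (curve p) \<in> faces V E pos crv" "faces_within p = {inside (curve p)}"
proof -
  note J = jordan_curve_cycle[OF p]
  have sub: "set (closed_walk_edges p) \<subseteq> E" using p by (simp add: is_cycle_def)
  have "path_image (crv e) \<inter> inside (curve p) = {}" if e: "e \<in> E" for e
  proof (rule ccontr)
    assume meet: "\<not> ?thesis"
    then have "e \<subseteq> set p" using edge_meeting_inside[OF p e] by blast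
    then have "e \<in> set (closed_walk_edges p)" using assms(2) e by (auto simp: chords_def)
    then have "path_image (crv e) \<subseteq> curve p" by (auto simp: curve_def img_def)
    then show False using inside_no_overlap[of "curve p"] meet by blast
  qed
  then have empty: "inside (curve p) \<inter> drawing V E pos crv = {}"
    using vertex_not_inside_cycle[OF p] by (auto simp: drawing_eq img_def)
  have "curve p \<subseteq> drawing V E pos crv" using sub by (auto simp: drawing_eq curve_def img_def)
  then show "inside (curve p) \<in> faces V E pos crv"
    using connected_subset_inside[OF _ _ _ J] empty jordan_curveD(1,3)[OF J]
    by (intro faceI) blast+
  then show "faces_within p = {inside (curve p)}"
    using faceD(4)[OF _ jordan_curveD(3)[OF J] empty] by (auto simp: faces_within_def)
qed

text \<open>Cutting along a chord distributes the faces and the other chords among the two halves: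
  two halves with \<open>c1\<close> and \<open>c2\<close> chords have
  \<open>(c1 + 1) + (c2 + 1)\<close> faces, and the cycle has \<open>c1 + c2 + 1\<close>
  chords.\<close>

lemma card_faces_within:
  assumes "is_cycle p"
  shows "finite (faces_within p) \<and> card (faces_within p) = Suc (card (chords p))"
  using assms
proof (induction "length p" arbitrary: p rule: less_induct)
  case less
  show ?case
  proof (cases "chords p = {}")
    case True
    then show ?thesis using chordless_cycle_face(2)[OF less.prems] by simp
  next
    case False
    then obtain e where e: "e \<in> chords p" by blast
    obtain x xs y ys where q: "e = {x, y}" "xs \<noteq> []" "ys \<noteq> []" "distinct (x # xs @ y # ys)"
      "set (x # xs @ y # ys) = set p" "length (x # xs @ y # ys) = length p"
      "set (closed_walk_edges (x # xs @ y # ys)) = set (closed_walk_edges p)"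
      using obtain_chord_split[OF less.prems e] by metis
    note cong = is_cycle_cong[OF less.prems q(4-7)]
    define p1 p2 where "p1 = x # xs @ [y]" and "p2 = y # ys @ [x]"
    have xy: "{x, y} \<in> E" using e q(1) by (auto simp: chords_def)
    note halves = cycle_halves[OF cong(1) q(2,3) xy, folded p1_def p2_def]
    note ins = inside_halves[OF cong(1) q(2,3) xy, folded p1_def p2_def, unfolded cong(2)]
    have len: "length p1 < length p" "length p2 < length p"
      using q by (auto simp flip: q(6) simp: p1_def p2_def)
    note IH = less.hyps[OF len(1) halves(1)] less.hyps[OF len(2) halves(2)]
    have op: "open (inside (curve p1))" "open (inside (curve p2))"
      using jordan_curveD(2) jordan_curve_cycle halves by blast+
    have f_split: "f \<subseteq> inside (curve p1) \<or> f \<subseteq> inside (curve p2)" if f: "f \<in> faces_within p" for f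
    proof -
      have face: "f \<in> faces V E pos crv" using f by (simp add: faces_within_def)
      have "path_image (crv {x, y}) \<inter> f = {}"
        using faceD(3)[OF face] xy by (auto simp: img_def)
      then have "f \<subseteq> inside (curve p1) \<union> inside (curve p2)"
        using f ins(2) by (auto simp: faces_within_def)
      \<comment> \<open>A connected set cannot meet both of two disjoint open sets that cover
        it.\<close>
      then show ?thesis
        using connectedD[OF faceD(1)[OF face] op] ins(1) by blast
    qed
    have "faces_within p = faces_within p1 \<union> faces_within p2"
      using f_split ins(2) by (auto simp: faces_within_def)
    moreover have "faces_within p1 \<inter> faces_within p2 = {}"
      using ins(1) faceD(2) by (fastforce simp: faces_within_def)
    ultimately have fin: "finite (faces_within p)"
      and cf: "card (faces_within p) = card (faces_within p1) + card (faces_within p2)"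
      using IH by (simp_all add: card_Un_disjoint)
    have ch: "chords p = insert {x, y} (chords p1 \<union> chords p2)"
    proof (intro equalityI subsetI)
      fix d assume d: "d \<in> chords p"
      then have dE: "d \<in> E" "d \<subseteq> set p" by (auto simp: chords_def)
      have "d \<subseteq> set p1 \<or> d \<subseteq> set p2"
      proof (rule ccontr)
        assume no: "\<not> ?thesis"
        then obtain u v where uv: "u \<in> d" "u \<notin> set p2" "v \<in> d" "v \<notin> set p1" by blast
        then have "u \<in> set xs" "v \<in> set ys" using dE(2) q(5) by (auto simp: p1_def p2_def)
        moreover have "d = {u, v}"
          using edgeD[OF dE(1)] uv card_subset_eq[of d "{u, v}"] no \<open>u \<in> set xs\<close>
          by (auto simp: card_2_iff p1_def)
        ultimately show False using chords_do_not_cross[OF cong(1) xy] dE(1) by blast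
      qed
      moreover have "d \<notin> between x xs y \<union> between x (rev ys) y"
        using d q(7) cycle_split[of x xs y ys] by (auto simp: chords_def)
      ultimately show "d \<in> insert {x, y} (chords p1 \<union> chords p2)"
        using dE(1) halves(3,4) by (auto simp: chords_def)
    next
      fix d assume d: "d \<in> insert {x, y} (chords p1 \<union> chords p2)"
      have both: "d = {x, y}" if "d \<in> E" "d \<subseteq> set p1" "d \<subseteq> set p2" for d
      proof -
        have "d \<subseteq> {x, y}" using that q(4) by (auto simp: p1_def p2_def)
        then show ?thesis using edgeD[OF that(1)] card_subset_eq[of "{x, y}" d] q(4) by auto
      qed
      have "d \<in> E" "d \<subseteq> set p" using d xy q(5) by (auto simp: chords_def p1_def p2_def)
      moreover have "d \<notin> set (closed_walk_edges p)"
      proof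
        assume "d \<in> set (closed_walk_edges p)"
        then have *: "d \<in> between x xs y \<union> between x (rev ys) y" "d \<noteq> {x, y}"
          using q(7) cycle_split[of x xs y ys] e q(1) by (auto simp: chords_def)
        then have "d \<notin> chords p1 \<or> d \<notin> chords p2" "d \<in> chords p1 \<union> chords p2"
          using d halves(3,4) by (auto simp: chords_def)
        moreover have "between x xs y \<subseteq> Pow (set p1)" "between x (rev ys) y \<subseteq> Pow (set p2)"
          using Union_between[of x xs y] Union_between[of x "rev ys" y]
          by (auto simp: p1_def p2_def)
        ultimately show False
          using * both[of d] halves(3,4) by (auto simp: chords_def)
      qed
      ultimately show "d \<in> chords p" by (simp add: chords_def)
    qed
    have "chords p1 \<inter> chords p2 = {}"
    proof -
      have "set p1 \<inter> set p2 = {x, y}" using q(4) by (auto simp: p1_def p2_def)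
      then have "d = {x, y}" if "d \<in> chords p1 \<inter> chords p2" for d
        using that edgeD[of d] card_subset_eq[of "{x, y}" d] q(4) by (auto simp: chords_def)
      then show ?thesis using halves(3) by (auto simp: chords_def)
    qed
    moreover have "{x, y} \<notin> chords p1 \<union> chords p2" using halves(3,4) by (auto simp: chords_def)
    moreover have "finite (chords p1)" "finite (chords p2)"
      using finite_E by (auto simp: chords_def)
    ultimately have "card (chords p) = Suc (card (chords p1) + card (chords p2))"
      by (simp add: ch card_Un_disjoint)
    then show ?thesis using fin cf IH by simp
  qed
qed

text \<open>All of the drawing lies on the Hamiltonian curve or inside it, so the outside of the
  curve is one face and all others are faces within; this adds one to the count of
  \<open>card_faces_within\<close>.\<close>

lemma card_faces:
  assumes H: "is_cycle p" "set p = V"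
  shows "card (faces V E pos crv) = card (chords p) + 2"
proof -
  note J = jordan_curve_cycle[OF H(1)]
  have sub: "set (closed_walk_edges p) \<subseteq> E" using H by (simp add: is_cycle_def)
  have "path_image (crv e) \<subseteq> inside (curve p) \<union> curve p" if e: "e \<in> E" for e
  proof (cases "e \<in> chords p")
    case True
    then show ?thesis
      using closure_mono[OF chord_inside[OF H(1) True]] edge_ends_in_closure[OF e] jordan_curveD(13)[OF J]
      by blast
  next
    case False
    then show ?thesis
      using edgeD[OF e] H(2) e by (auto simp: chords_def curve_def img_def)
  qed
  moreover have "pos ` V \<subseteq> curve p"
    using pos_in_img_iff[OF sub] H(2) Union_closed_walk_edges[of p] by (auto simp: curve_def)
  ultimately have "drawing V E pos crv \<subseteq> inside (curve p) \<union> curve p"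
    by (auto simp: drawing_eq img_def)
  then have empty: "outside (curve p) \<inter> drawing V E pos crv = {}"
    using jordan_curveD(9,10)[OF J] by blast
  have sub': "curve p \<subseteq> drawing V E pos crv" using sub by (auto simp: drawing_eq curve_def img_def)
  then have out: "outside (curve p) \<in> faces V E pos crv"
    using connected_subset_outside[OF _ _ _ J] empty jordan_curveD(4,6)[OF J]
    by (intro faceI) blast+
  have "f = outside (curve p) \<or> f \<subseteq> inside (curve p)" if f: "f \<in> faces V E pos crv" for f
  proof -
    have dis: "f \<inter> curve p = {}"
      using faceD(3)[OF f] sub by (auto simp: curve_def img_def)
    show ?thesis
    proof (cases "f \<inter> outside (curve p) = {}")
      case True
      then show ?thesis using dis jordan_curveD(10)[OF J] by blast
    next
      case False
      then have "f \<subseteq> outside (curve p)" using connected_subset_outside[OF faceD(1)[OF f] dis _ J] by blast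
      then show ?thesis using faceD(4)[OF f jordan_curveD(6)[OF J] empty] by blast
    qed
  qed
  then have "faces V E pos crv = insert (outside (curve p)) (faces_within p)"
    using out by (auto simp: faces_within_def)
  moreover have "outside (curve p) \<notin> faces_within p"
    using jordan_curveD(4,9)[OF J] unfolding faces_within_def by blast
  ultimately show ?thesis using card_faces_within[OF H(1)] by simp
qed

text \<open>\<open>odd_face\<close> only provides some odd boundary walk. Its edges are drawn in the
  frontier, which is the curve of \<open>q\<close>, so they are edges of \<open>q\<close>, and an
  even cycle contains no odd closed walk.\<close>

lemma chordless_cycle_odd:
  assumes odd: "\<And>f. f \<in> faces V E pos crv \<Longrightarrow> bounded f \<Longrightarrow> odd_face V E pos crv f"
    and q: "is_cycle q" "chords q = {}"
  shows "odd (length q)"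
proof
  assume ev: "even (length q)"
  note J = jordan_curve_cycle[OF q(1)]
  have sub: "set (closed_walk_edges q) \<subseteq> E" using q by (simp add: is_cycle_def)
  obtain p where p: "boundary_walk V E pos crv (inside (curve q)) p" "odd (length p)"
    using odd[OF chordless_cycle_face(1)[OF q] jordan_curveD(7)[OF J]] by (auto simp: odd_face_def)
  have "set (closed_walk_edges p) \<subseteq> set (closed_walk_edges q)"
  proof
    fix e assume e: "e \<in> set (closed_walk_edges p)"
    then have eE: "e \<in> E" using p(1) by (auto simp: boundary_walk_def closed_walk_def)
    have "path_image (crv e) \<subseteq> img (set (closed_walk_edges q))"
      using e p(1) jordan_curveD(11)[OF J] by (auto simp: boundary_walk_def curve_def)
    then show "e \<in> set (closed_walk_edges q)"
      using open_edge_disjoint_img[OF eE sub] open_edge_nonempty[OF eE] by blast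
  qed
  then have "even (length p)" using closed_walk_parity ev q(1) by (auto simp: is_cycle_def)
  then show False using p(2) by simp
qed

end

section \<open>The Hamiltonian cycle\<close>

text \<open>Going backwards along the walk, a vertex is prepended unless it lies in
  \<open>A\<close>, where the path restarts, or occurs already, where the loop is cut off.\<close>

lemma shorten_walk:
  assumes "p \<noteq> []" "last p \<in> A"
  shows "\<exists>q. q \<noteq> [] \<and> hd q = hd p \<and> distinct q \<and> set q \<subseteq> set p \<and> last q \<in> A \<and>
    set (butlast q) \<inter> A = {} \<and> set (path_edges q) \<subseteq> set (path_edges p)"
  using assms
proof (induction p)
  case (Cons x p)
  show ?case
  proof (cases "x \<in> A")
    case True
    then show ?thesis by (intro exI[of _ "[x]"]) auto
  next
    case False
    then have "p \<noteq> []" using Cons.prems by auto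
    then obtain q where q: "q \<noteq> []" "hd q = hd p" "distinct q" "set q \<subseteq> set p" "last q \<in> A"
      "set (butlast q) \<inter> A = {}" "set (path_edges q) \<subseteq> set (path_edges p)"
      using Cons by auto
    show ?thesis
    proof (cases "x \<in> set q")
      case True
      then obtain as bs where ab: "q = as @ x # bs" using split_list by metis
      have "set (path_edges (x # bs)) \<subseteq> set (path_edges (x # p))"
        using q(7) \<open>p \<noteq> []\<close> path_edges_append[of as x bs] ab by (cases p) auto
      then show ?thesis
        using q ab by (intro exI[of _ "x # bs"]) (auto simp: butlast_append)
    next
      case x: False
      have "set (path_edges (x # q)) \<subseteq> set (path_edges (x # p))"
        using q(1,2,7) \<open>p \<noteq> []\<close> by (cases p; cases q) auto
      then show ?thesis
        using q x False by (intro exI[of _ "x # q"]) auto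
    qed
  qed
qed simp

lemma set_closed_walk_edges_Cons:
  assumes "q \<noteq> []"
  shows "set (closed_walk_edges (x # q)) = {{x, hd q}, {last q, x}} \<union> set (path_edges q)"
proof -
  obtain y qs where "q = y # qs" using assms by (cases q) auto
  then have "path_edges (x # q @ [x]) = {x, hd q} # path_edges (q @ [x])" by simp
  moreover have "path_edges (q @ [x]) = path_edges q @ [{last q, x}]"
    using path_edges_append[of "butlast q" "last q" "[x]"] assms by (cases q rule: rev_cases) auto
  ultimately show ?thesis by (auto simp: closed_walk_edges_conv)
qed

lemma connected_neighbour:
  assumes "connected_graph V E" "u \<in> V" "w \<in> V" "u \<noteq> w"
  obtains y where "{u, y} \<in> E" "y \<in> V"
proof -
  obtain p where p: "p \<noteq> []" "hd p = u" "last p = w" "set p \<subseteq> V" "set (path_edges p) \<subseteq> E"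
    using assms(1)[unfolded connected_graph_def walk_between_def successively_edges_iff] assms(2,3)
    by blast
  show thesis using that p assms(4) by (cases p rule: path_edges.cases) auto
qed

lemma connected_path_to:
  assumes "connected_graph V E" "u \<in> V" "w \<in> V" "w \<in> A"
  obtains q where "q \<noteq> []" "hd q = u" "distinct q" "set q \<subseteq> V" "last q \<in> A"
    "set (butlast q) \<inter> A = {}" "set (path_edges q) \<subseteq> E"
proof -
  obtain p where p: "p \<noteq> []" "hd p = u" "last p = w" "set p \<subseteq> V" "set (path_edges p) \<subseteq> E"
    using assms(1)[unfolded connected_graph_def walk_between_def successively_edges_iff] assms(2,3)
    by blast
  obtain q where "q \<noteq> []" "hd q = hd p" "distinct q" "set q \<subseteq> set p" "last q \<in> A"
    "set (butlast q) \<inter> A = {}" "set (path_edges q) \<subseteq> set (path_edges p)"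
    using shorten_walk[OF p(1), of A] p(3) assms(4) by auto
  then show thesis using that p by (metis subset_trans)
qed

context plane_graph
begin

lemma connected_delete:
  assumes "k_connected 2 V E"
  shows "connected_graph V E" "\<And>x. x \<in> V \<Longrightarrow> connected_graph (V - {x}) {e \<in> E. x \<notin> e}"
proof -
  have *: "\<And>X. X \<subseteq> V \<Longrightarrow> card X < 2 \<Longrightarrow> connected_graph (V - X) {e \<in> E. e \<inter> X = {}}"
    using assms by (auto simp: k_connected_def)
  show "connected_graph V E" using *[of "{}"] by simp
  show "connected_graph (V - {x}) {e \<in> E. x \<notin> e}" if "x \<in> V" for x
    using *[of "{x}"] that by simp
qed

text \<open>Deleting a neighbour \<open>u\<close> of \<open>x\<close> leaves \<open>x\<close>
  another neighbour \<open>y\<close>; deleting \<open>x\<close> leaves a path from \<open>u\<close>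
  to \<open>y\<close>, which \<open>x\<close> closes to a cycle.\<close>

lemma exists_cycle:
  assumes "k_connected 2 V E"
  shows "\<exists>p. is_cycle p"
proof -
  note conn = connected_delete[OF assms]
  have V: "finite V" "card V > 2" using simple assms by (auto simp: simple_graph_def k_connected_def)
  have other: "\<exists>w\<in>V. w \<notin> {x, u}" for x u
  proof (rule ccontr)
    assume "\<not> ?thesis"
    then have "card V \<le> card {x, u}" by (intro card_mono) auto
    also have "\<dots> \<le> 2" by (simp add: card_insert_if)
    finally show False using V(2) by simp
  qed
  obtain x where x: "x \<in> V" using other by blast
  obtain w where "w \<in> V" "w \<noteq> x" using other[of x x] by auto
  then obtain u where u: "{x, u} \<in> E" "u \<in> V" using connected_neighbour[OF conn(1) x] by metis
  have ux: "u \<noteq> x" using edgeD[OF u(1)] by auto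
  obtain w' where "w' \<in> V" "w' \<notin> {x, u}" using other by blast
  then obtain y where y: "{x, y} \<in> {e \<in> E. u \<notin> e}" "y \<in> V - {u}"
    using connected_neighbour[OF conn(2)[OF u(2)], of x w'] x ux by auto
  have yx: "y \<noteq> x" using y edgeD[of "{x, y}"] by auto
  obtain q where q: "q \<noteq> []" "hd q = u" "distinct q" "set q \<subseteq> V - {x}" "last q \<in> {y}"
    "set (path_edges q) \<subseteq> {e \<in> E. x \<notin> e}"
    using connected_path_to[OF conn(2)[OF x], of u y "{y}"] u(2) ux y(2) yx by blast
  have "length q \<ge> 2"
    using q(1,2,5) y(2) by (cases q rule: path_edges.cases) auto
  then have "is_cycle (x # q)"
    unfolding is_cycle_def set_closed_walk_edges_Cons[OF q(1)]
    using q u(1) y(1) by (auto simp: insert_commute)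
  then show ?thesis by blast
qed

end

context outerplane_graph
begin

text \<open>A vertex off a longest cycle would yield an ear. By the theta curve the ear cannot be
  drawn inside the cycle, so it encloses a vertex-free part of the cycle, that is, a single
  edge; replacing this edge by the ear gives a longer cycle.\<close>

lemma hamiltonian:
  assumes "k_connected 2 V E"
  obtains p where "is_cycle p" "set p = V"
proof -
  note conn = connected_delete[OF assms]
  have "finite V" using simple by (simp add: simple_graph_def)
  have "length q < Suc (card V)" if "is_cycle q" for q
    using card_mono[OF \<open>finite V\<close> is_cycle_vertices[OF that]] distinct_card[of q] that
    by (simp add: is_cycle_def)
  then obtain p where p: "is_cycle p" and max: "\<And>q. is_cycle q \<Longrightarrow> length q \<le> length p"
    using exists_cycle[OF assms] ex_has_greatest_nat[of is_cycle _ length "Suc (card V)"]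
    by (metis less_imp_le)
  have "V \<subseteq> set p"
  proof (rule ccontr)
    assume "\<not> V \<subseteq> set p"
    then obtain v where v: "v \<in> V" "v \<notin> set p" by blast
    have pV: "set p \<subseteq> V" and lp: "length p \<ge> 3" "distinct p" "p \<noteq> []"
      using is_cycle_vertices[OF p] p by (auto simp: is_cycle_def)
    \<comment> \<open>Only the last edge \<open>{u, x}\<close> of this path matters:
      \<open>u\<close> is off the cycle and \<open>x\<close> on it.\<close>
    obtain q where q: "q \<noteq> []" "hd q = v" "last q \<in> set p" "set (butlast q) \<inter> set p = {}"
      "set (path_edges q) \<subseteq> E" "set q \<subseteq> V"
      using connected_path_to[OF conn(1) v(1), of "hd p" "set p"] pV lp(3) hd_in_set
      by (metis subsetD)
    define x where "x = last q"
    have "butlast q \<noteq> []" using q(1-3) v(2) by (cases q rule: path_edges.cases) auto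
    then obtain q' u where u: "q = q' @ [u, x]"
      using append_butlast_last_id[of q] append_butlast_last_id[of "butlast q"] q(1) unfolding x_def
      by (metis append.assoc append_Cons append_Nil)
    have ux: "{u, x} \<in> E" "u \<notin> set p" "x \<in> set p" "u \<in> V"
      using q(3-6) path_edges_append[of q' u "[x]"] by (auto simp: u butlast_append)
    have "\<exists>y\<in>set p. y \<noteq> x"
    proof (rule ccontr)
      assume "\<not> ?thesis"
      then have "card (set p) \<le> card {x}" by (intro card_mono) auto
      then show False using distinct_card[OF lp(2)] lp(1) by simp
    qed
    then obtain y0 where y0: "y0 \<in> set p" "y0 \<noteq> x" by blast
    \<comment> \<open>Without \<open>x\<close> the graph is still connected, so \<open>u\<close>
      reaches the cycle at some \<open>y\<close> other than \<open>x\<close>; \<open>y0\<close>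
      serves as a target that survives the deletion. Together with \<open>{u, x}\<close> this is an
      ear, whose inner vertices \<open>zs\<close> start with \<open>u\<close>.\<close>
    obtain r where r: "r \<noteq> []" "hd r = u" "distinct r" "set r \<subseteq> V - {x}" "last r \<in> set p"
      "set (butlast r) \<inter> set p = {}" "set (path_edges r) \<subseteq> {e \<in> E. x \<notin> e}"
      using connected_path_to[OF conn(2), of x u y0 "set p"] pV ux y0 by blast
    define y zs where "y = last r" and "zs = butlast r"
    have rz: "r = zs @ [y]" using r(1) by (simp add: y_def zs_def)
    have zs: "zs \<noteq> []" using r(2) ux(2) r(5) rz by auto
    have y: "y \<in> set p" "y \<noteq> x" using r(4,5) rz by auto
    have dz: "distinct (x # zs @ [y])" "set zs \<inter> set p = {}" using r(3,4,6) rz by auto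
    have ez: "between x zs y \<subseteq> E"
    proof -
      have "path_edges (x # zs @ [y]) = {x, u} # path_edges (zs @ [y])"
        using zs r(2) rz by (cases zs) auto
      then show ?thesis using ux(1) r(7) rz by (auto simp: between_def insert_commute)
    qed
    obtain xs ys where c: "distinct (x # xs @ y # ys)" "set (x # xs @ y # ys) = set p"
      "set (closed_walk_edges (x # xs @ y # ys)) = set (closed_walk_edges p)"
      "length (x # xs @ y # ys) = length p"
      using obtain_rotation[OF lp(2) ux(3) y(1)] y(2) by metis
    have e: "between x xs y \<subseteq> E" "between x (rev ys) y \<subseteq> E"
      using p c(3) cycle_split[of x xs y ys] by (auto simp: is_cycle_def)
    have dis: "set xs \<inter> set zs = {}" "set ys \<inter> set zs = {}" using c(2) dz(2) by auto
    \<comment> \<open>Otherwise \<open>theta_chord\<close> would leave the ear without inner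
      vertices.\<close>
    have "xs = [] \<or> ys = []"
      using theta_chord(1)[of x xs y "rev ys" zs] c(1) dz(1) dis e ez zs by auto
    then show False
    proof
      assume "xs = []"
      have "is_cycle (x # zs @ y # ys)"
        unfolding is_cycle_def cycle_split using c(1) dz(1) dis ez e zs by (auto simp: Suc_le_eq)
      from max[OF this] show False using c(4) zs \<open>xs = []\<close> by (cases zs) auto
    next
      assume "ys = []"
      have "is_cycle (y # rev zs @ x # xs)"
        unfolding is_cycle_def cycle_split
        using c(1) dz(1) dis ez e zs between_rev[of y zs x] between_rev[of y xs x]
        by (auto simp: Suc_le_eq)
      from max[OF this] show False using c(4) zs \<open>ys = []\<close> by (cases zs) auto
    qed
  qed
  then show thesis using that p is_cycle_vertices[OF p] by blast
qed

end

section \<open>Noncrossing cycles on linearly ordered vertices\<close>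

lemma closed_walk_edges_map: "closed_walk_edges (map f l) = map ((`) f) (closed_walk_edges l)"
proof -
  have "map f l ! (Suc i mod length l) = f (l ! (Suc i mod length l))" if "i < length l" for i
    using that by (intro nth_map mod_less_divisor) auto
  then show ?thesis by (auto simp: closed_walk_edges_def)
qed

lemma drop_split:
  assumes "i < j" "j \<le> length l"
  shows "drop i l = l ! i # take (j - Suc i) (drop (Suc i) l) @ drop j l"
proof -
  have "drop (Suc i) l = take (j - Suc i) (drop (Suc i) l) @ drop j l"
    using append_take_drop_id[of "j - Suc i" "drop (Suc i) l"] assms by simp
  then show ?thesis using Cons_nth_drop_Suc[of i l] assms by simp
qed

lemma adjacent_in_sorted:
  fixes l :: "nat list"
  assumes "sorted_wrt (<) l" "a \<in> set l" "b \<in> set l" "a < b" "\<And>v. v \<in> set l \<Longrightarrow> a < v \<Longrightarrow> \<not> v < b"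
  shows "{a, b} \<in> set (path_edges l)"
proof -
  obtain as bs where l: "l = as @ a # bs" using split_list[OF assms(2)] by blast
  have "b \<in> set bs" using assms(1,3,4) l by (auto simp: sorted_wrt_append)
  then obtain c cs where bs: "bs = c # cs" by (cases bs) auto
  have "c = b" using assms(1,5) \<open>b \<in> set bs\<close> l bs by (fastforce simp: sorted_wrt_append)
  then show ?thesis using path_edges_append[of as a bs] l bs by simp
qed

lemma successively_invariant:
  assumes "successively (\<lambda>u v. P u \<longleftrightarrow> P v) t" "u \<in> set t" "v \<in> set t"
  shows "P u \<longleftrightarrow> P v"
proof -
  have "P u \<longleftrightarrow> P (hd t)" if "u \<in> set t" for u
    using assms(1) that
  proof (induction t arbitrary: u)
    case (Cons x t)
    show ?case
    proof (cases "u = x")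
      case False
      then have u: "u \<in> set t" using Cons.prems by simp
      then have "t \<noteq> []" by auto
      then have "P x \<longleftrightarrow> P (hd t)" "successively (\<lambda>u v. P u \<longleftrightarrow> P v) t"
        using Cons.prems(1) by (simp_all add: successively_Cons)
      then show ?thesis using Cons.IH[OF _ u] by simp
    qed simp
  qed simp
  then show ?thesis using assms(2,3) by blast
qed

lemma closed_walk_edges_superset: "set (path_edges l) \<subseteq> set (closed_walk_edges l)"
  using set_closed_walk_edges_Cons[of "tl l" "hd l"]
  by (cases l rule: path_edges.cases) auto

text \<open>Once an edge \<open>{x, y}\<close> of the cycle is fixed, the remaining vertices form a path none of
  whose edges crosses \<open>{x, y}\<close>; so either all or none of them lie between \<open>x\<close> and \<open>y\<close>.\<close>

lemma noncrossing_cycle_sorted: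
  fixes r :: "nat list"
  assumes r: "distinct r" "length r \<ge> 3"
    and cross: "\<And>a b c d. {a, b} \<in> set (closed_walk_edges r) \<Longrightarrow> {c, d} \<in> set (closed_walk_edges r) \<Longrightarrow>
      a < c \<Longrightarrow> c < b \<Longrightarrow> \<not> b < d"
  shows "set (closed_walk_edges (sorted_list_of_set (set r))) = set (closed_walk_edges r)"
proof -
  define l where "l = sorted_list_of_set (set r)"
  have l: "sorted_wrt (<) l" "set l = set r" "distinct l" "length l = length r"
    by (auto simp: l_def strict_sorted_iff distinct_card[OF r(1)])
  have "e \<in> set (closed_walk_edges l)" if e: "e \<in> set (closed_walk_edges r)" for e
  proof -
    obtain x y t where t: "e = {x, y}" "distinct (x # y # t)" "set (x # y # t) = set r"
      "set (closed_walk_edges (x # y # t)) = set (closed_walk_edges r)"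
      using obtain_edge_rotation[OF r(1) e r(2)] by metis
    define a b where "a = min x y" and "b = max x y"
    have ab: "e = {a, b}" "a < b" "a \<in> set l" "b \<in> set l"
      using t by (auto simp: a_def b_def l(2) min_def max_def)
    have te: "set (path_edges t) \<subseteq> set (closed_walk_edges r)"
      unfolding t(4)[symmetric] using closed_walk_edges_superset[of "x # y # t"]
      by (cases t) auto
    have not_ab: "v \<noteq> a \<and> v \<noteq> b" if "v \<in> set t" for v
      using that t(2) by (auto simp: a_def b_def min_def max_def)
    have "successively (\<lambda>u v. {u, v} \<in> set (path_edges t)) t" by (simp add: successively_edges_iff)
    then have "successively (\<lambda>u v. (a < u \<and> u < b) = (a < v \<and> v < b)) t"
    proof (rule successively_mono)
      fix u v assume uv: "{u, v} \<in> set (path_edges t)"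
      have "{u, v} \<subseteq> set t" using path_edges_subset[OF uv] .
      then have "u \<noteq> a" "u \<noteq> b" "v \<noteq> a" "v \<noteq> b" using not_ab by auto
      moreover have *: "{a, b} \<in> set (closed_walk_edges r)" "{u, v} \<in> set (closed_walk_edges r)"
        "{v, u} \<in> set (closed_walk_edges r)"
        using e ab uv te by (auto simp: insert_commute)
      ultimately show "(a < u \<and> u < b) = (a < v \<and> v < b)"
        using cross[OF *(1,2)] cross[OF *(1,3)] cross[OF *(2,1)] cross[OF *(3,1)]
        by linarith
    qed
    then have same: "(a < u \<and> u < b) = (a < v \<and> v < b)" if "u \<in> set t" "v \<in> set t" for u v
      using successively_invariant[of "\<lambda>u. a < u \<and> u < b"] that by blast
    have sl: "set l = {a, b} \<union> set t"
      using t(1,3) ab(1) l(2) by auto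
    show ?thesis
    proof (cases "\<exists>u\<in>set t. a < u \<and> u < b")
      case True
      then obtain u where u: "u \<in> set t" "a < u" "u < b" by blast
      \<comment> \<open>All vertices lie between \<open>a\<close> and \<open>b\<close>, so these are
        the ends of the sorted list and the edge is its closing edge.\<close>
      have inb: "a \<le> v \<and> v \<le> b" if "v \<in> set l" for v
        using same[OF u(1), of v] u that sl ab(2) by auto
      have ne: "l \<noteq> []" "tl l \<noteq> []" using r(2) l(4) by (cases l; cases "tl l"; auto)+
      have "hd l = a" using l(1) ab(3) inb[of "hd l"] ne(1) by (cases l) auto
      moreover have "last l = b"
        using l(1) ab(4) inb[of "last l"] ne(1) by (cases l rule: rev_cases) (auto simp: sorted_wrt_append)
      ultimately show ?thesis
        using set_closed_walk_edges_Cons[of "tl l" "hd l"] ne ab(1)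
        by (cases l) (auto simp: insert_commute)
    next
      case False
      \<comment> \<open>No vertex lies between \<open>a\<close> and \<open>b\<close>, so they are
        consecutive in the sorted list.\<close>
      then have "{a, b} \<in> set (path_edges l)"
        using ab sl by (intro adjacent_in_sorted[OF l(1)]) auto
      then show ?thesis using closed_walk_edges_superset[of l] ab(1) by blast
    qed
  qed
  then have "set (closed_walk_edges r) \<subseteq> set (closed_walk_edges l)" by blast
  \<comment> \<open>Both closed walks have as many edges as vertices, so one inclusion is
    enough.\<close>
  moreover have "card (set (closed_walk_edges r)) = card (set (closed_walk_edges l))"
    using card_closed_walk_edges[OF r] card_closed_walk_edges[of l] l r by simp
  ultimately show ?thesis unfolding l_def[symmetric] using card_subset_eq[of "set (closed_walk_edges l)"] by auto
qed

section \<open>Cycles of the graph as polygons\<close>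

context outerplane_graph
begin

definition adjacent_at :: "'a list \<Rightarrow> nat \<Rightarrow> nat \<Rightarrow> bool" where
  "adjacent_at h i j \<longleftrightarrow> i < j \<and> j < length h \<and> {h ! i, h ! j} \<in> E"

context
  fixes h :: "'a list"
  assumes ham: "is_cycle h" "set h = V"
    and odd_faces: "\<And>f. f \<in> faces V E pos crv \<Longrightarrow> bounded f \<Longrightarrow> odd_face V E pos crv f"
begin

lemma ham_simps: "distinct h" "length h \<ge> 3" "set (closed_walk_edges h) \<subseteq> E"
  using ham by (auto simp: is_cycle_def)

lemma nth_h_eq_iff: "i < length h \<Longrightarrow> j < length h \<Longrightarrow> h ! i = h ! j \<longleftrightarrow> i = j"
  using ham_simps(1) nth_eq_iff_index_eq by blast

lemma inj_nth_h: "inj_on ((!) h) {..<length h}"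
  by (auto simp: inj_on_def nth_h_eq_iff)

lemma edge_adjacent_at:
  assumes "{h ! i, h ! j} \<in> E" "i < length h" "j < length h"
  shows "adjacent_at h (min i j) (max i j)"
proof -
  have "i \<noteq> j" using edgeD[OF assms(1)] by auto
  then show ?thesis using assms by (auto simp: adjacent_at_def min_def max_def insert_commute)
qed

text \<open>Rotating \<open>h\<close> to start at position \<open>a\<close> puts positions
  \<open>c\<close> and \<open>d\<close> on different sides of the chord from \<open>a\<close> to
  \<open>b\<close>, so that \<open>chords_do_not_cross\<close> applies.\<close>

lemma adjacent_at_nested:
  assumes "adjacent_at h a b" "adjacent_at h c d" "a < c" "c < b"
  shows "\<not> b < d"
proof
  assume "b < d"
  have lt: "a < b" "b < length h" "c < d" "d < length h"
    and E: "{h ! a, h ! b} \<in> E" "{h ! c, h ! d} \<in> E"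
    using assms by (auto simp: adjacent_at_def)
  define xs ys where "xs = take (b - Suc a) (drop (Suc a) h)" and "ys = drop (Suc b) h @ take a h"
  have eq: "drop a h @ take a h = h ! a # xs @ h ! b # ys"
    using drop_split[of a b h] lt Cons_nth_drop_Suc[of b h] by (simp add: xs_def ys_def)
  define p where "p = h ! a # xs @ h ! b # ys"
  have rot: "p = rotate a h" using eq lt by (simp add: p_def rotate_drop_take)
  have "set (closed_walk_edges p) = set (closed_walk_edges h)"
    using set_closed_walk_edges_rotate[of "take a h" "drop a h"] eq by (simp add: p_def)
  then have "is_cycle p"
    using ham(1) rot by (intro is_cycle_cong(1)[OF ham(1)]) (auto simp: is_cycle_def)
  moreover have "h ! c \<in> set xs"
  proof -
    have "xs ! (c - Suc a) = h ! c" "c - Suc a < length xs"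
      using assms(3,4) lt by (auto simp: xs_def)
    then show ?thesis by (metis nth_mem)
  qed
  moreover have "h ! d \<in> set ys"
  proof -
    have "drop (Suc b) h ! (d - Suc b) = h ! d" "d - Suc b < length (drop (Suc b) h)"
      using \<open>b < d\<close> lt by auto
    then show ?thesis by (metis UnI1 nth_mem set_append ys_def)
  qed
  ultimately show False using chords_do_not_cross[of "h ! a" xs "h ! b" ys "h ! c" "h ! d"] E
    by (simp add: p_def)
qed

lemma cycle_of_polygon:
  assumes "length l \<ge> 3" "successively (adjacent_at h) l" "adjacent_at h (hd l) (last l)"
  shows "is_cycle (map ((!) h) l)" "set l \<subseteq> {..<length h}" "sorted_wrt (<) l"
proof -
  have "successively (<) l"
    using assms(2) by (rule successively_mono) (auto simp: adjacent_at_def)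
  then show s: "sorted_wrt (<) l" by (simp add: successively_conv_sorted_wrt transp_on_less)
  show bound: "set l \<subseteq> {..<length h}"
  proof
    fix x assume "x \<in> set l"
    then have "x \<le> last l"
      using s by (cases l rule: rev_cases) (auto simp: sorted_wrt_append)
    then show "x \<in> {..<length h}" using assms(3) by (auto simp: adjacent_at_def)
  qed
  have ne: "l \<noteq> []" "tl l \<noteq> []" using assms(1) by (cases l; cases "tl l"; auto)+
  have "{h ! u, h ! v} \<in> E" if "{u, v} \<in> set (closed_walk_edges l)" for u v
  proof -
    have "set (path_edges l) \<subseteq> {{u, v} |u v. adjacent_at h u v}"
      unfolding successively_edges_iff[symmetric]
      by (rule successively_mono[OF assms(2)]) auto
    moreover have "set (closed_walk_edges l) = insert {last l, hd l} (set (path_edges l))"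
      using set_closed_walk_edges_Cons[of "tl l" "hd l"] ne
      by (cases l rule: path_edges.cases) auto
    ultimately have "\<exists>u' v'. {u, v} = {u', v'} \<and> adjacent_at h u' v'"
      using that assms(3) insert_commute[of "last l" "hd l" "{}"] by auto
    then show ?thesis by (auto simp: doubleton_eq_iff adjacent_at_def insert_commute)
  qed
  moreover have "\<exists>u v. e = {u, v}" if "e \<in> set (closed_walk_edges l)" for e
    using that by (auto simp: closed_walk_edges_def)
  ultimately have "set (closed_walk_edges (map ((!) h) l)) \<subseteq> E"
    by (force simp: closed_walk_edges_map)
  moreover have "distinct (map ((!) h) l)"
    using s inj_on_subset[OF inj_nth_h bound] by (simp add: distinct_map strict_sorted_iff)
  ultimately show "is_cycle (map ((!) h) l)" using assms(1) by (simp add: is_cycle_def)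
qed

interpretation nested_chords "length h" "adjacent_at h"
proof
  show "adjacent_at h i (Suc i)" if "Suc i < length h" for i
  proof -
    have "{h ! i, h ! Suc i} \<in> set (closed_walk_edges h)"
      using that by (auto simp: closed_walk_edges_def intro!: image_eqI[of _ _ i])
    then show ?thesis using that ham_simps(3) by (auto simp: adjacent_at_def)
  qed
  show "adjacent_at h 0 (length h - 1)"
  proof -
    have "Suc (length h - 1) = length h" using ham_simps(2) by simp
    then have "Suc (length h - 1) mod length h = 0" by simp
    then have "{h ! (length h - 1), h ! 0} \<in> set (closed_walk_edges h)"
      unfolding closed_walk_edges_def set_map
      by (intro image_eqI[of _ _ "length h - 1"]) (use ham_simps(2) in auto)
    then show ?thesis using ham_simps(2,3) by (auto simp: adjacent_at_def insert_commute)
  qed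
  show "odd (length l)"
    if l: "length l \<ge> 3" "successively (adjacent_at h) l" "adjacent_at h (hd l) (last l)"
      and chordless: "\<And>u v. u \<in> set l \<Longrightarrow> v \<in> set l \<Longrightarrow> adjacent_at h u v \<Longrightarrow>
        {u, v} \<in> set (closed_walk_edges l)" for l
  proof -
    note c = cycle_of_polygon[OF l]
    have "e \<in> set (closed_walk_edges (map ((!) h) l))"
      if e: "e \<in> E" "e \<subseteq> set (map ((!) h) l)" for e
    proof -
      obtain x y where "e = {x, y}" using edgeD[OF e(1)] by (auto simp: card_2_iff)
      then obtain i j where ij: "e = {h ! i, h ! j}" "i \<in> set l" "j \<in> set l"
        using e(2) by auto
      then have "{min i j, max i j} \<in> set (closed_walk_edges l)"
        using edge_adjacent_at[of i j] e(1) c(2)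
        by (intro chordless) (auto simp: min_def max_def)
      moreover have "{min i j, max i j} = {i, j}" by (auto simp: min_def max_def)
      ultimately show ?thesis
        using ij(1) by (auto simp: closed_walk_edges_map intro!: image_eqI[of _ _ "{i, j}"])
    qed
    then have "chords (map ((!) h) l) = {}" by (auto simp: chords_def)
    then show ?thesis using chordless_cycle_odd[OF odd_faces c(1)] by simp
  qed
  show "\<not> b < d" if "adjacent_at h a b" "adjacent_at h c d" "a < c" "c < b" for a b c d
    using adjacent_at_nested[OF that] .
qed (use ham_simps(2) in \<open>auto simp: adjacent_at_def\<close>)

text \<open>Of the edges, \<open>length h - 1\<close> join consecutive positions and the others are
  long. The Hamiltonian cycle uses one long edge, from first to last position, so there is one more
  long edge than there are chords.\<close>

lemma card_faces_eq: "card (faces V E pos crv) = card (long_edges 0 (length h - 1)) + 1"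
proof -
  let ?L = "long_edges 0 (length h - 1)"
  let ?S = "(\<lambda>i. (i, Suc i)) ` {..<length h - 1}"
  let ?f = "\<lambda>(i, j). {h ! i, h ! j}"
  have R: "{(i, j). adjacent_at h i j} = ?L \<union> ?S"
    using R_bound R_less R_Suc by (fastforce simp: long_edges_def)
  have "bij_betw ?f {(i, j). adjacent_at h i j} E"
    unfolding bij_betw_def
  proof (intro conjI equalityI subsetI inj_onI)
    fix p q assume pq: "p \<in> {(i, j). adjacent_at h i j}" "q \<in> {(i, j). adjacent_at h i j}" "?f p = ?f q"
    obtain i j k l where "p = (i, j)" "q = (k, l)" by (cases p; cases q)
    with pq show "p = q"
      by (auto simp: doubleton_eq_iff adjacent_at_def nth_h_eq_iff)
  next
    fix e assume e: "e \<in> E"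
    obtain x y where xy: "e = {x, y}" using edgeD[OF e] by (auto simp: card_2_iff)
    then obtain i j where ij: "e = {h ! i, h ! j}" "i < length h" "j < length h"
      using edgeD[OF e] ham(2) by (auto simp: in_set_conv_nth)
    have "{h ! min i j, h ! max i j} = e" using ij by (auto simp: min_def max_def)
    then show "e \<in> ?f ` {(i, j). adjacent_at h i j}"
      using edge_adjacent_at[of i j] ij e by (intro image_eqI[of _ _ "(min i j, max i j)"]) auto
  qed (auto simp: adjacent_at_def)
  then have "card E = card (?L \<union> ?S)" using bij_betw_same_card R by metis
  also have "\<dots> = card ?L + card ?S"
    by (intro card_Un_disjoint finite_long_edges) (auto simp: long_edges_def)
  also have "card ?S = length h - 1" by (subst card_image) (auto simp: inj_on_def)
  finally have "card E = card ?L + (length h - 1)" .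
  moreover have "chords h = E - set (closed_walk_edges h)"
    using edgeD ham(2) by (auto simp: chords_def)
  then have "card (chords h) = card E - length h"
    using card_Diff_subset[OF _ ham_simps(3)] card_closed_walk_edges[OF ham_simps(1,2)] by simp
  moreover have "length h \<le> card E"
    using card_mono[OF finite_E ham_simps(3)] card_closed_walk_edges[OF ham_simps(1,2)] by simp
  ultimately show ?thesis using card_faces[OF ham] ham_simps(2) by linarith
qed

text \<open>The cycle is rewritten in positions and sorted. Since edges do not cross,
  \<open>noncrossing_cycle_sorted\<close> shows that sorting does not change the edge set.\<close>

lemma polygon_of_cycle:
  assumes "is_cycle q"
  obtains l where "l \<in> polygons" "set (map ((!) h) l) = set q"
    "set (closed_walk_edges (map ((!) h) l)) = set (closed_walk_edges q)"
proof -
  define idx where "idx v = (THE i. i < length h \<and> h ! i = v)" for v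
  have idx: "idx v < length h \<and> h ! idx v = v" if "v \<in> set h" for v
    unfolding idx_def by (rule theI') (use that ham_simps(1) in \<open>auto simp: distinct_Ex1\<close>)
  define r where "r = map idx q"
  have qV: "set q \<subseteq> set h" using is_cycle_vertices[OF assms] ham(2) by simp
  then have hr: "map ((!) h) r = q" using idx by (auto simp: r_def intro!: map_idI)
  have q: "distinct q" "length q \<ge> 3" "set (closed_walk_edges q) \<subseteq> E"
    using assms by (auto simp: is_cycle_def)
  have r: "distinct r" "length r \<ge> 3" "set r \<subseteq> {..<length h}"
  proof -
    show "distinct r" using q(1) unfolding hr[symmetric] distinct_map by blast
    show "length r \<ge> 3" using q(2) by (simp add: r_def)
    show "set r \<subseteq> {..<length h}" using idx qV by (auto simp: r_def)
  qed
  have rE: "adjacent_at h u v" if "{u, v} \<in> set (closed_walk_edges r)" "u < v" for u v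
  proof -
    have "{u, v} \<subseteq> {..<length h}" using closed_walk_edges_subset[OF that(1)] r(3) by blast
    moreover have "{h ! u, h ! v} \<in> set (closed_walk_edges q)"
      unfolding hr[symmetric] closed_walk_edges_map using that(1) by (auto intro: image_eqI[of _ _ "{u, v}"])
    ultimately show ?thesis using q(3) that(2) by (auto simp: adjacent_at_def)
  qed
  define l where "l = sorted_list_of_set (set r)"
  have l: "sorted_wrt (<) l" "set l = set r" "length l = length r"
    by (auto simp: l_def strict_sorted_iff distinct_card[OF r(1)])
  have edges: "set (closed_walk_edges l) = set (closed_walk_edges r)"
    unfolding l_def
  proof (rule noncrossing_cycle_sorted[OF r(1,2)])
    fix a b c d :: nat
    assume *: "{a, b} \<in> set (closed_walk_edges r)" "{c, d} \<in> set (closed_walk_edges r)" "a < c" "c < b"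
    show "\<not> b < d"
    proof
      assume "b < d"
      then show False using R_nested[of a b c d] rE[OF *(1)] rE[OF *(2)] *(3,4) by simp
    qed
  qed
  have "l \<in> polygons"
    unfolding polygons_def
  proof (intro CollectI conjI)
    show "3 \<le> length l" using l r by simp
    have "successively (\<lambda>x y. {x, y} \<in> set (closed_walk_edges l)) l"
      using successively_edges_iff closed_walk_edges_superset by blast
    moreover have "successively (<) l" using l(1) by (rule successively_if_sorted_wrt)
    ultimately show "successively (adjacent_at h) l"
      using rE edges by (simp add: successively_conv_nth)
    have "hd l < last l" "{hd l, last l} \<in> set (closed_walk_edges l)"
    proof -
      obtain x xs where x: "l = x # xs" "xs \<noteq> []"
        using l(3) r(2) by (cases l rule: path_edges.cases) auto
      show "hd l < last l" using l(1) x by simp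
      show "{hd l, last l} \<in> set (closed_walk_edges l)"
        using set_closed_walk_edges_Cons[OF x(2), of x] x by (auto simp: insert_commute)
    qed
    then show "adjacent_at h (hd l) (last l)" using rE edges by simp
  qed
  moreover have "set (map ((!) h) l) = set q" unfolding hr[symmetric] using l(2) by simp
  moreover have "set (closed_walk_edges (map ((!) h) l)) = set (closed_walk_edges q)"
    unfolding hr[symmetric] closed_walk_edges_map using edges by simp
  ultimately show ?thesis using that by blast
qed

text \<open>An increasing list is determined by its set, so distinct polygons yield cycles with
  distinct vertex sets. The predicate \<open>P\<close> is kept abstract to serve both
  parities.\<close>

lemma card_cycles_eq: "card {(W, C) \<in> cycles V E. P (card C)} = card {l \<in> polygons. P (length l)}"
proof -
  let ?F = "\<lambda>l. (set (map ((!) h) l), set (closed_walk_edges (map ((!) h) l)))"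
  have cyc: "is_cycle (map ((!) h) l)" "set l \<subseteq> {..<length h}" "sorted_wrt (<) l"
    if "l \<in> polygons" for l
    using cycle_of_polygon that by (auto simp: polygons_def)
  have cycles: "cycles V E = {(set p, set (closed_walk_edges p)) |p. is_cycle p}"
    using is_cycle_vertices by (fastforce simp: cycles_def closed_walk_def is_cycle_def)
  have card: "card (set (closed_walk_edges (map ((!) h) l))) = length l" if "l \<in> polygons" for l
    using card_closed_walk_edges[of "map ((!) h) l"] cyc(1)[OF that] by (simp add: is_cycle_def)
  have "inj_on ?F polygons"
  proof (rule inj_onI)
    fix l l' assume l: "l \<in> polygons" "l' \<in> polygons" "?F l = ?F l'"
    then have "(!) h ` set l = (!) h ` set l'" by simp
    then have "set l = set l'"
      using inj_on_image_eq_iff[OF inj_nth_h] cyc(2) l(1,2) by metis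
    then show "l = l'" using cyc(3) l(1,2) strict_sorted_equal by metis
  qed
  then have "card (?F ` {l \<in> polygons. P (length l)}) = card {l \<in> polygons. P (length l)}"
    by (intro card_image) (auto intro: inj_on_subset)
  moreover have "?F ` {l \<in> polygons. P (length l)} = {(W, C) \<in> cycles V E. P (card C)}"
  proof (intro equalityI subsetI)
    fix z assume "z \<in> ?F ` {l \<in> polygons. P (length l)}"
    then obtain l where l: "z = ?F l" "l \<in> polygons" "P (length l)" by blast
    then show "z \<in> {(W, C) \<in> cycles V E. P (card C)}"
      using card[OF l(2)] cyc(1)[OF l(2)] unfolding cycles by (simp del: set_map) blast
  next
    fix z assume z: "z \<in> {(W, C) \<in> cycles V E. P (card C)}"
    then obtain q where q: "z = (set q, set (closed_walk_edges q))" "is_cycle q"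
      "P (card (set (closed_walk_edges q)))"
      unfolding cycles by auto
    obtain l where l: "l \<in> polygons" "set (map ((!) h) l) = set q"
      "set (closed_walk_edges (map ((!) h) l)) = set (closed_walk_edges q)"
      using polygon_of_cycle[OF q(2)] .
    have "z = ?F l" using q(1) l(2,3) by simp
    moreover have "P (length l)" using q(3) l card by metis
    ultimately show "z \<in> ?F ` {l \<in> polygons. P (length l)}" using l(1) by blast
  qed
  ultimately show ?thesis by simp
qed

lemma cycle_count_bounds:
  assumes "card (faces V E pos crv) \<ge> 3"
  shows "2 * c_even V E + (card (faces V E pos crv) - 1) \<le> 2 * c_odd V E"
    "c_odd V E < c_even V E + (card (faces V E pos crv) - 1)"
    "card (faces V E pos crv) - 1 \<le> Suc (c_even V E)"
  using polygon_parity_bounds assms card_cycles_eq[of odd] card_cycles_eq[of even]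
  unfolding c_odd_def c_even_def card_faces_eq by simp_all

end

end

theorem theorem3p1:
  fixes V :: "'a set" and E :: "'a set set"
    and pos :: "'a \<Rightarrow> complex" and crv :: "'a set \<Rightarrow> real \<Rightarrow> complex"
  assumes "simple_graph V E"
    and "k_connected 2 V E"
    and "plane_embedding V E pos crv"
    and "all_vertices_on_infinite_face V E pos crv"
    and "\<And>f. f \<in> faces V E pos crv \<Longrightarrow> bounded f \<Longrightarrow> odd_face V E pos crv f"
    and "card (faces V E pos crv) \<ge> 3"
  shows "c_even V E > 0
    \<and> (real (card (faces V E pos crv)) - 1) / (2 * real (c_even V E)) + 1
        \<le> real (c_odd V E) / real (c_even V E)
    \<and> real (c_odd V E) / real (c_even V E)
        \<le> (real (card (faces V E pos crv)) - 2) / real (c_even V E) + 1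
    \<and> 1 \<le> real (c_odd V E) / real (c_even V E)
    \<and> real (c_odd V E) / real (c_even V E) \<le> 2"
proof -
  interpret outerplane_graph V E pos crv
    using assms(1,3,4) by unfold_locales
  obtain h where h: "is_cycle h" "set h = V" using hamiltonian[OF assms(2)] .
  define F co ce where "F = card (faces V E pos crv)" and "co = c_odd V E" and "ce = c_even V E"
  have b: "F \<ge> 3" "2 * ce + (F - 1) \<le> 2 * co" "co < ce + (F - 1)" "F - 1 \<le> Suc ce"
    using cycle_count_bounds[OF h assms(5,6)] assms(6) by (simp_all add: F_def co_def ce_def)
  \<comment> \<open>As \<open>F \<ge> 3\<close>, the subtraction \<open>F - 1\<close> is not
    truncated. The bound \<open>F - 1 \<le> Suc ce\<close> gives both \<open>ce > 0\<close> and,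
    with \<open>co - ce \<le> F - 2 \<le> ce\<close>, the final bound 2.\<close>
  then have "ce > 0" "2 * real ce + (real F - 1) \<le> 2 * real co"
    "real co \<le> real ce + (real F - 2)" "real F - 2 \<le> real ce" by linarith+
  note ineqs = this
  have "(real F - 1) / (2 * real ce) + 1 = ((real F - 1) / 2 + real ce) / real ce"
    using ineqs(1) by (simp add: field_simps)
  moreover have "(real F - 1) / 2 + real ce \<le> real co"
    using ineqs(2) by (simp add: field_simps)
  then have "((real F - 1) / 2 + real ce) / real ce \<le> real co / real ce"
    by (rule divide_right_mono) simp
  ultimately have lower: "(real F - 1) / (2 * real ce) + 1 \<le> real co / real ce" by simp
  have "real co / real ce \<le> (real F - 2 + real ce) / real ce"
    using ineqs(3) by (intro divide_right_mono) auto
  then have upper: "real co / real ce \<le> (real F - 2) / real ce + 1"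
    using ineqs(1) by (simp add: add_divide_distrib)
  have "1 \<le> real co / real ce" "real co / real ce \<le> 2"
    using ineqs b(1) by (simp_all add: field_simps)
  then show ?thesis
    using ineqs(1) lower upper unfolding F_def co_def ce_def by simp
qed

end
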